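(* Let $u_0,u_1$ be weights in $\mathbb R^n$ and $w_0,w_1$ weights in $\mathbb R^+$. If $0<p_0\le1$, $0<p_1<\infty$ and $w_1\in B_{p_1/p_0}$, then $M:\Lambda^{p_0}_{u_0}(w_0)\to\Lambda^{p_1,\infty}_{u_1}(w_1)$ is bounded if and only if there is $C<\infty$ such that, for every finite family of cubes $(Q_j)_{j=1}^J$ and every family of measurable sets $(E_j)_{j=1}^J$ with $E_j\subset Q_j$ for every $j$, $$\frac{W_1^{1/p_1}\big(u_1\big(\bigcup_jQ_j\big)\big)}{W_0^{1/p_0}\big(u_0\big(\bigcup_jE_j\big)\big)}\le C\max_j\frac{|Q_j|}{|E_j|}.$$
   Context: $M$ is the Hardy–Littlewood maximal operator $Mf(x)=\sup_{x\in Q}\frac1{|Q|}\int_Q|f(y)|\,dy$, the supremum over all cubes $Q\ni x$ in $\mathbb R^n$ with sides parallel to the axes; all cubes are of this type. A weight $u$ in $\mathbb R^n$ is a nonnegative locally integrable function, not identically zero; $u(A)=\int_Au(x)\,dx$. Each weight $w_i$ in $\mathbb R^+=(0,\infty)$ is a nonnegative measurable function with $W_i(t)=\int_0^tw_i(s)\,ds<\infty$ for $t<\infty$, supported in $[0,u_i(\mathbb R^n)]$ and not identically zero. For a weight $u$ in $\mathbb R^n$ and a weight $w$ in $\mathbb R^+$ with $W(t)=\int_0^tw$: $\lambda^u_f(t)=u(\{|f|>t\})$, $f^*_u(t)=\inf\{s>0:\lambda^u_f(s)\le t\}$, $\|f\|_{\Lambda^p_u(w)}=\big(\int_0^\infty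 (f^*_u(t))^pw(t)\,dt\big)^{1/p}$, $\|f\|_{\Lambda^{p,\infty}_u(w)}=\sup_{t>0}W^{1/p}(t)f^*_u(t)$. Boundedness of $M$ means $\|Mf\|\le C\|f\|$ (in the respective functionals) for all $f$ in the first space, $C$ independent of $f$. For $0<q<\infty$, $w\in B_q$ means that the Hardy operator $Ag(t)=\frac1t\int_0^tg(s)\,ds$ satisfies $\|Ag\|_{L^q(w)}\le C\|g\|_{L^q(w)}$ for all nonnegative nonincreasing $g$ on $\mathbb R^+$, where $\|g\|_{L^q(w)}=(\int_0^\infty|g|^qw)^{1/q}$. Conventions: $0/0=\infty/\infty=0\cdot\infty=0$, $a/0=\infty$ for $a>0$. *)

theory Defs
  imports "HOL-Analysis.Analysis"
begin

text \<open>All norms and integrals below are taken in \<^typ>\<open>ennreal\<close>, where \<open>0 / 0 = \<infinity> / \<infinity> = 0 * \<infinity> = 0\<close>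
  and \<open>a / 0 = \<infinity>\<close> for \<open>a > 0\<close>, as required.\<close>

text \<open>Real powers on \<open>[0, \<infinity>]\<close>, meant for exponents \<open>p > 0\<close> only.\<close>

definition epow :: "ennreal \<Rightarrow> real \<Rightarrow> ennreal" where
  "epow x p = (if x = \<infinity> then \<infinity> else ennreal (enn2real x powr p))"

text \<open>Cubes are closed and nondegenerate, \<open>One\<close> being the vector with all coordinates 1.\<close>

definition cube :: "(real ^ 'n) set \<Rightarrow> bool" where
  "cube Q \<longleftrightarrow> (\<exists>a r. 0 < r \<and> Q = cbox a (a + r *\<^sub>R One))"

definition maximal :: "(real ^ 'n \<Rightarrow> complex) \<Rightarrow> real ^ 'n \<Rightarrow> ennreal" where
  "maximal f x = (SUP Q\<in>{Q. cube Q \<and> x \<in> Q}.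
     (\<integral>\<^sup>+y\<in>Q. ennreal (cmod (f y)) \<partial>lebesgue) / emeasure lebesgue Q)"

text \<open>Weights are understood up to null sets: being nonzero means being nonzero on a set of
  positive Lebesgue measure. Measurability of \<open>u\<close> is part of local integrability.\<close>

definition weight :: "(real ^ 'n \<Rightarrow> real) \<Rightarrow> bool" where
  "weight u \<longleftrightarrow> (\<forall>x. 0 \<le> u x) \<and> (\<forall>K. compact K \<longrightarrow> u absolutely_integrable_on K) \<and>
     \<not> (AE x in lebesgue. u x = 0)"

definition weight_measure :: "(real ^ 'n \<Rightarrow> real) \<Rightarrow> (real ^ 'n) set \<Rightarrow> ennreal" where
  "weight_measure u A = (\<integral>\<^sup>+x\<in>A. ennreal (u x) \<partial>lebesgue)"

definition primitive :: "(real \<Rightarrow> real) \<Rightarrow> ennreal \<Rightarrow> ennreal" where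
  "primitive w t = (\<integral>\<^sup>+s\<in>{s. 0 < s \<and> ennreal s < t}. ennreal (w s) \<partial>lebesgue)"

text \<open>A weight in \<open>(0, \<infinity>)\<close> supported in \<open>[0, u(\<real>\<^sup>n)]\<close>, again up to null sets. Values of \<open>w\<close>
  outside \<open>(0, \<infinity>)\<close> are irrelevant throughout.\<close>

definition weight_pos :: "(real ^ 'n \<Rightarrow> real) \<Rightarrow> (real \<Rightarrow> real) \<Rightarrow> bool" where
  "weight_pos u w \<longleftrightarrow> set_borel_measurable lebesgue {0<..} w \<and> (\<forall>s>0. 0 \<le> w s) \<and>
     (\<forall>t::real. primitive w (ennreal t) < \<infinity>) \<and>
     (AE s in lebesgue. 0 < s \<longrightarrow> weight_measure u UNIV < ennreal s \<longrightarrow> w s = 0) \<and>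
     \<not> (AE s in lebesgue. 0 < s \<longrightarrow> w s = 0)"

text \<open>The functionals below take the \<open>[0, \<infinity>]\<close>-valued function \<open>|f|\<close> as argument, since \<open>M f\<close>
  may be infinite.\<close>

definition distr_fun :: "(real ^ 'n \<Rightarrow> real) \<Rightarrow> (real ^ 'n \<Rightarrow> ennreal) \<Rightarrow> real \<Rightarrow> ennreal" where
  "distr_fun u F s = weight_measure u {x. ennreal s < F x}"

definition rearr :: "(real ^ 'n \<Rightarrow> real) \<Rightarrow> (real ^ 'n \<Rightarrow> ennreal) \<Rightarrow> real \<Rightarrow> ennreal" where
  "rearr u F t = (INF s\<in>{s. 0 < s \<and> distr_fun u F s \<le> ennreal t}. ennreal s)"

definition lorentz_norm ::
  "(real ^ 'n \<Rightarrow> real) \<Rightarrow> (real \<Rightarrow> real) \<Rightarrow> real \<Rightarrow> (real ^ 'n \<Rightarrow> ennreal) \<Rightarrow> ennreal" where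
  "lorentz_norm u w p F =
     epow (\<integral>\<^sup>+t\<in>{0<..}. epow (rearr u F t) p * ennreal (w t) \<partial>lebesgue) (1 / p)"

definition weak_lorentz_norm ::
  "(real ^ 'n \<Rightarrow> real) \<Rightarrow> (real \<Rightarrow> real) \<Rightarrow> real \<Rightarrow> (real ^ 'n \<Rightarrow> ennreal) \<Rightarrow> ennreal" where
  "weak_lorentz_norm u w p F =
     (SUP t\<in>{0<..}. epow (primitive w (ennreal t)) (1 / p) * rearr u F t)"

definition maximal_bounded_weak ::
  "(real ^ 'n \<Rightarrow> real) \<Rightarrow> (real \<Rightarrow> real) \<Rightarrow> real \<Rightarrow> (real ^ 'n \<Rightarrow> real) \<Rightarrow> (real \<Rightarrow> real) \<Rightarrow> real \<Rightarrow> bool"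
where
  "maximal_bounded_weak u0 w0 p0 u1 w1 p1 \<longleftrightarrow> (\<exists>C<\<infinity>. \<forall>f \<in> borel_measurable lebesgue.
     lorentz_norm u0 w0 p0 (\<lambda>x. ennreal (cmod (f x))) < \<infinity> \<longrightarrow>
     weak_lorentz_norm u1 w1 p1 (maximal f)
       \<le> C * lorentz_norm u0 w0 p0 (\<lambda>x. ennreal (cmod (f x))))"

definition Lq_norm :: "(real \<Rightarrow> real) \<Rightarrow> real \<Rightarrow> (real \<Rightarrow> ennreal) \<Rightarrow> ennreal" where
  "Lq_norm w q g = epow (\<integral>\<^sup>+t\<in>{0<..}. epow (g t) q * ennreal (w t) \<partial>lebesgue) (1 / q)"

definition hardy :: "(real \<Rightarrow> real) \<Rightarrow> real \<Rightarrow> ennreal" where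
  "hardy g t = (\<integral>\<^sup>+s\<in>{0<..<t}. ennreal (g s) \<partial>lebesgue) / ennreal t"

definition B_class :: "real \<Rightarrow> (real \<Rightarrow> real) set" where
  "B_class q = {w. \<exists>C<\<infinity>. \<forall>g. (\<forall>s>0. 0 \<le> g s) \<and> antimono_on {0<..} g \<longrightarrow>
     Lq_norm w q (hardy g) \<le> C * Lq_norm w q (\<lambda>s. ennreal (g s))}"

end

theory Submission
  imports Defs
begin

text \<open>Necessity: test the operator on the indicator function of \<open>\<Union>j. E\<^sub>j\<close>.

  Sufficiency: write \<open>q = p1 / p0\<close>. A superlevel set of \<open>M \<chi>\<^sub>E\<close> is a countable union of cubes
  \<open>Q\<close>, and the condition applied to finitely many of them with the sets \<open>E \<inter> Q\<close> gives the
  inequality for indicator functions. For general \<open>f\<close> and a level \<open>y\<close>,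
  \<open>|f| \<le> y / 2 + (\<Sum>k. 2 ^ k * y * \<chi>\<^sub>k)\<close> with \<open>\<chi>\<^sub>k\<close> the indicator function of
  \<open>{|f| > 2 ^ k * y / 2}\<close>, so that \<open>M f > y\<close> forces \<open>(\<Sum>k. (2 ^ k * M \<chi>\<^sub>k) powr p0) > 2 powr - p0\<close>
  because \<open>p0 \<le> 1\<close>. The weak functional of exponent \<open>q\<close> is countably subadditive up to a constant:
  the class \<open>B_class q\<close> yields \<open>W t \<le> C * (t / s) powr (q - \<epsilon>) * W s\<close> for \<open>s < t\<close>, so a function
  with weak bound \<open>b\<close> has integral at most \<open>D * t * W t powr (- 1 / q) * b\<close> over a set of
  measure \<open>t\<close>, and integrals are additive. Summing the bounds for the \<open>\<chi>\<^sub>k\<close> gives a geometric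
  series dominated by the Lorentz norm of \<open>f\<close>.\<close>

section \<open>Powers, primitives and the weak functional\<close>

lemma le_divide_ennreal_iff:
  assumes "0 < z"
  shows "a \<le> C / ennreal z \<longleftrightarrow> ennreal z * a \<le> C"
proof -
  have z: "ennreal z \<noteq> 0" "ennreal z < top" using assms by auto
  show ?thesis
    using divide_less_ennreal[OF z, of C a] by (simp add: not_less[symmetric] mult.commute)
qed

lemma divide_ennreal_le_iff:
  assumes "0 < z"
  shows "C / ennreal z \<le> a \<longleftrightarrow> C \<le> ennreal z * a"
proof -
  have "C / ennreal z * ennreal z = C"
    using assms by (simp add: ennreal_divide_times ennreal_divide_self)
  then have "C \<le> ennreal z * a" if "C / ennreal z \<le> a"
    using mult_right_mono[OF that, of "ennreal z"] by (simp add: mult.commute)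
  then show ?thesis
    using assms by (auto intro: divide_le_posI_ennreal)
qed

lemma less_divide_ennreal_iff:
  assumes "0 < z"
  shows "a < C / ennreal z \<longleftrightarrow> ennreal z * a < C"
  using divide_ennreal_le_iff[OF assms, of C a] by (simp add: not_le[symmetric])

text \<open>For \<open>b = 0\<close> a finite quotient forces \<open>a = 0\<close>, because
  \<open>a / 0\<close> is infinite for \<open>a > 0\<close>. Finiteness of \<open>b\<close> excludes
  \<open>a / \<infinity> = 0\<close>, which carries no information on \<open>a\<close>.\<close>

lemma divide_le_imp_le_mult_ennreal:
  fixes a b c :: ennreal
  assumes "a / b \<le> c" "b < top" "c < top"
  shows "a \<le> c * b"
proof (cases "b = 0")
  case True
  then have "a = 0"
    using assms by (auto split: if_splits simp: top_unique)
  then show ?thesis by simp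
next
  case False
  then have "b = ennreal (enn2real b)" "0 < enn2real b"
    using assms by (auto simp: enn2real_positive_iff zero_less_iff_neq_zero)
  then show ?thesis
    using divide_ennreal_le_iff[of "enn2real b" a c] assms by (simp add: mult.commute)
qed

lemma epow_ennreal: "0 \<le> x \<Longrightarrow> epow (ennreal x) p = ennreal (x powr p)"
  by (simp add: epow_def)

lemma epow_top [simp]: "epow top p = top"
  by (simp add: epow_def)

lemma epow_0 [simp]: "epow 0 p = 0"
  by (simp add: epow_def)

lemma epow_one [simp]: "epow 1 p = 1"
  by (simp add: epow_def)

lemma epow_1 [simp]: "epow x 1 = x"
  by (cases x) (auto simp: epow_ennreal)

lemma epow_mono:
  assumes "x \<le> y" "0 < p"
  shows "epow x p \<le> epow y p"
proof (cases y)
  case (real b)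
  then obtain a where "x = ennreal a" "0 \<le> a" "a \<le> b"
    using assms by (cases x) (auto simp: top_unique)
  then show ?thesis
    using real assms by (simp add: epow_ennreal powr_mono2 ennreal_leI)
qed simp

lemma epow_mult:
  assumes "0 < p"
  shows "epow (x * y) p = epow x p * epow y p"
proof (cases x; cases y)
  fix a b assume "x = ennreal a" "y = ennreal b" "0 \<le> a" "0 \<le> b"
  then show ?thesis
    by (simp add: epow_ennreal powr_mult flip: ennreal_mult)
next
  fix a assume *: "x = ennreal a" "y = top" "0 \<le> a"
  then show ?thesis
    by (cases "a = 0") (auto simp: epow_ennreal ennreal_mult_top ennreal_mult_eq_top_iff)
next
  fix b assume *: "x = top" "y = ennreal b" "0 \<le> b"
  then show ?thesis
    by (cases "b = 0") (auto simp: epow_ennreal ennreal_top_mult)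
qed simp

lemma epow_epow: "epow (epow x p) q = epow x (p * q)"
  by (cases x) (auto simp: epow_ennreal powr_powr)

lemma epow_inverse:
  assumes "0 < p"
  shows "epow (epow x p) (1 / p) = x" "epow (epow x (1 / p)) p = x"
  using assms by (simp_all add: epow_epow)

lemma epow_le_iff:
  assumes "0 < p"
  shows "epow x p \<le> y \<longleftrightarrow> x \<le> epow y (1 / p)"
  using assms epow_inverse[OF assms] epow_mono[of "epow x p" y "1 / p"] epow_mono[of x "epow y (1 / p)" p]
  by auto

lemma epow_strict_mono:
  assumes "x < y" "0 < p"
  shows "epow x p < epow y p"
  using assms epow_le_iff[of p y "epow x p"] by (simp add: epow_inverse not_le[symmetric])

text \<open>After division by \<open>s = a + b\<close> both fractions lie in [0, 1], where a number
  is at most its power with exponent \<open>p \<le> 1\<close>; the fractions add up to 1.\<close>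

lemma epow_add_le:
  assumes "0 < p" "p \<le> 1"
  shows "epow (x + y) p \<le> epow x p + epow y p"
proof (cases "x = top \<or> y = top")
  case False
  then obtain a b where ab: "x = ennreal a" "y = ennreal b" "0 \<le> a" "0 \<le> b"
    by (metis ennreal_cases)
  have "(a + b) powr p \<le> a powr p + b powr p"
  proof (cases "a + b = 0")
    case True
    then show ?thesis using ab by simp
  next
    case False
    define s where "s = a + b"
    have s: "0 < s" using False ab s_def by linarith
    have *: "c / s \<le> (c / s) powr p" if "0 \<le> c" "c \<le> s" for c
    proof (cases "c = 0")
      case False
      then show ?thesis
        using that s assms powr_mono'[of p 1 "c / s"] by simp
    qed simp
    have "1 = a / s + b / s"
      using s by (simp add: s_def add_divide_distrib[symmetric])
    also have "\<dots> \<le> (a / s) powr p + (b / s) powr p"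
      using *[of a] *[of b] ab s_def by simp
    also have "\<dots> = (a powr p + b powr p) / s powr p"
      using ab s by (simp add: powr_divide add_divide_distrib)
    finally show ?thesis
      using s by (simp add: s_def field_simps)
  qed
  then show ?thesis
    using ab by (simp add: epow_ennreal flip: ennreal_plus)
qed auto

lemma epow_suminf_le:
  assumes "0 < p" "p \<le> 1"
  shows "epow (\<Sum>k. x k) p \<le> (\<Sum>k. epow (x k) p)"
proof -
  have fin: "epow (\<Sum>k<n. x k) p \<le> (\<Sum>k<n. epow (x k) p)" for n
  proof (induction n)
    case (Suc n)
    have "epow (\<Sum>k<Suc n. x k) p \<le> epow (\<Sum>k<n. x k) p + epow (x n) p"
      using epow_add_le[OF assms] by simp
    also have "\<dots> \<le> (\<Sum>k<Suc n. epow (x k) p)"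
      using Suc by (simp add: add_right_mono)
    finally show ?case .
  qed simp
  \<comment> \<open>With the power moved to the right-hand side, a bound on all partial sums
    suffices, and no continuity of \<open>epow\<close> has to be proved.\<close>
  have "(\<Sum>k. x k) \<le> epow (\<Sum>k. epow (x k) p) (1 / p)"
  proof (rule suminf_le_const)
    show "(\<Sum>k<n. x k) \<le> epow (\<Sum>k. epow (x k) p) (1 / p)" for n
      using fin[of n] sum_le_suminf[of "\<lambda>k. epow (x k) p" "{..<n}"]
      by (simp add: epow_le_iff[OF assms(1), symmetric] order_trans)
  qed simp
  then show ?thesis
    using assms(1) by (simp add: epow_le_iff)
qed

lemma borel_measurable_epow [measurable]:
  assumes "f \<in> borel_measurable M"
  shows "(\<lambda>x. epow (f x) p) \<in> borel_measurable M"
  unfolding epow_def using assms by measurable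

section \<open>Monotonicity and left continuity of the primitive of a weight\<close>

lemma primitive_mono: "s \<le> t \<Longrightarrow> primitive w s \<le> primitive w t"
  unfolding primitive_def by (intro nn_integral_mono) (auto split: split_indicator)

lemma primitive_0 [simp]: "primitive w 0 = 0"
  by (simp add: primitive_def)

lemma measurable_pos_part:
  assumes "set_borel_measurable lebesgue {0<..} w" 
  shows "(\<lambda>s. ennreal (w s) * indicator {0<..} s) \<in> borel_measurable lebesgue"
proof -
  have "(\<lambda>s. ennreal (indicator {0<..} s *\<^sub>R w s)) \<in> borel_measurable lebesgue"
    using assms unfolding set_borel_measurable_def by measurable
  also have "(\<lambda>s. ennreal (indicator {0<..} s *\<^sub>R w s)) = (\<lambda>s. ennreal (w s) * indicator {0<..} s)"
    by (auto split: split_indicator)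
  finally show ?thesis .
qed

text \<open>The weight is known to be measurable only on the positive half-line, so it is kept
  together with \<open>indicator {0<..}\<close>; the endpoint \<open>t\<close> enters through a
  separate indicator.\<close>

lemma primitive_eq:
  "primitive w t = (\<integral>\<^sup>+s. (ennreal (w s) * indicator {0<..} s) * indicator {s. ennreal s < t} s \<partial>lebesgue)"
  unfolding primitive_def by (intro nn_integral_cong) (auto split: split_indicator)

lemma ennreal_less_measurable [measurable]: "{s. ennreal s < t} \<in> sets lebesgue"
proof -
  have "{s. ennreal s < t} \<in> sets borel" by measurable
  then show ?thesis by simp
qed

text \<open>Monotone convergence. As \<open>primitive\<close> integrates over the strict inequality
  \<open>ennreal s < t\<close>, the indicators converge at every point, also when the supremum is
  infinite.\<close>

lemma primitive_SUP:
  assumes w: "set_borel_measurable lebesgue {0<..} w" and t: "incseq t"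
  shows "primitive w (SUP n. t n) = (SUP n. primitive w (t n))"
proof -
  note [measurable] = measurable_pos_part[OF w]
  have "primitive w (SUP n. t n)
      = (\<integral>\<^sup>+s. (SUP n. (ennreal (w s) * indicator {0<..} s) * indicator {s. ennreal s < t n} s) \<partial>lebesgue)"
    unfolding primitive_eq
  proof (intro nn_integral_cong)
    fix s :: real
    have "indicator {s. ennreal s < (SUP n. t n)} s = (SUP n. indicator {s. ennreal s < t n} s :: ennreal)"
    proof (cases "ennreal s < (SUP n. t n)")
      case True
      then obtain n where "ennreal s < t n" by (auto simp: less_SUP_iff)
      then have "(1::ennreal) \<le> (SUP n. indicator {s. ennreal s < t n} s)"
        by (intro SUP_upper2[of n]) auto
      moreover have "(SUP n. indicator {s. ennreal s < t n} s) \<le> (1::ennreal)"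
        by (intro SUP_least) (auto split: split_indicator)
      ultimately show ?thesis using True by (auto intro: antisym)
    next
      case False
      then have "\<not> ennreal s < t n" for n by (meson SUP_upper UNIV_I less_le_trans)
      then show ?thesis using False by simp
    qed
    then show "(ennreal (w s) * indicator {0<..} s) * indicator {s. ennreal s < (SUP n. t n)} s
       = (SUP n. (ennreal (w s) * indicator {0<..} s) * indicator {s. ennreal s < t n} s)"
      by (simp add: SUP_mult_left_ennreal)
  qed
  also have "\<dots> = (SUP n. primitive w (t n))"
    unfolding primitive_eq
  proof (rule nn_integral_monotone_convergence_SUP)
    show "incseq (\<lambda>n s. (ennreal (w s) * indicator {0<..} s) * indicator {s. ennreal s < t n} s)"
      using t by (auto simp: incseq_def le_fun_def less_le_trans split: split_indicator)
  qed measurable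
  finally show ?thesis .
qed

lemma primitive_leI:
  assumes w: "set_borel_measurable lebesgue {0<..} w"
    and le: "\<And>t. t < L \<Longrightarrow> primitive w t \<le> c"
  shows "primitive w L \<le> c"
proof (cases "L = 0")
  case False
  then have "0 < L" by (simp add: zero_less_iff_neq_zero)
  then obtain u :: "nat \<Rightarrow> ennreal" where u: "\<And>n. u n < L" "u \<longlonglongrightarrow> L"
    using approx_from_below_dense_linorder[of 0 L] by auto
  \<comment> \<open>The sequence \<open>u\<close> approximating \<open>L\<close> from below need not
    be monotone, but its running maxima are, and they stay strictly below \<open>L\<close>.\<close>
  define t where "t n = Max (u ` {..n})" for n
  have t: "t n < L" for n
    using u(1) by (simp add: t_def)
  have "incseq t"
    unfolding t_def by (intro incseq_SucI Max_mono) (auto simp: le_SucI)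
  have "u n \<le> (SUP n. t n)" for n
    by (rule SUP_upper2[of n]) (auto simp: t_def)
  then have "L \<le> (SUP n. t n)"
    using u(2) by (intro LIMSEQ_le_const2) auto
  then have "L = (SUP n. t n)"
    using t by (intro antisym SUP_least) (auto simp: less_imp_le)
  then show ?thesis
    using primitive_SUP[OF w \<open>incseq t\<close>] le[OF t] by (auto intro: SUP_least)
qed simp

section \<open>The measure with density \<open>u\<close>\<close>

lemma weight_measure_mono: "A \<subseteq> B \<Longrightarrow> weight_measure u A \<le> weight_measure u B"
  unfolding weight_measure_def by (intro nn_integral_mono) (auto split: split_indicator)

text \<open>Local integrability makes each truncation to a ball measurable, and at every point the
  truncations are eventually equal to \<open>u\<close>.\<close>

lemma weight_measurable:
  assumes "weight (u :: real ^ 'n \<Rightarrow> real)"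
  shows "u \<in> borel_measurable lebesgue"
proof -
  have "(\<lambda>x. indicator (cball 0 (real n)) x *\<^sub>R u x) \<in> borel_measurable lebesgue" for n
  proof -
    have "u absolutely_integrable_on cball 0 (real n)"
      using assms by (simp add: weight_def)
    then show ?thesis by (auto simp: set_integrable_def dest: borel_measurable_integrable)
  qed
  moreover have "(\<lambda>n. indicator (cball 0 (real n)) x *\<^sub>R u x) \<longlonglongrightarrow> u x" for x
  proof (rule tendsto_eventually)
    obtain N where N: "norm x \<le> real N" using real_arch_simple by blast
    then have "norm x \<le> real n" if "N \<le> n" for n
      using that by (meson of_nat_mono order_trans)
    then show "\<forall>\<^sub>F n in sequentially. indicator (cball 0 (real n)) x *\<^sub>R u x = u x"
      by (auto simp: eventually_sequentially intro!: exI[of _ N])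
  qed
  ultimately show ?thesis by (rule borel_measurable_LIMSEQ_metric[where f = "\<lambda>n x. indicator (cball 0 (real n)) x *\<^sub>R u x"])
qed

lemma weight_measure_finite:
  assumes "weight (u :: real ^ 'n \<Rightarrow> real)" "A \<subseteq> K" "compact K"
  shows "weight_measure u A < \<infinity>"
proof -
  have int: "integrable lebesgue (\<lambda>x. indicator K x *\<^sub>R u x)" and nn: "\<And>x. 0 \<le> u x"
    using assms by (auto simp: weight_def set_integrable_def)
  have "weight_measure u A \<le> weight_measure u K"
    by (rule weight_measure_mono[OF assms(2)])
  also have "\<dots> = (\<integral>\<^sup>+x. ennreal (norm (indicator K x *\<^sub>R u x)) \<partial>lebesgue)"
    unfolding weight_measure_def using nn by (intro nn_integral_cong) (auto split: split_indicator)
  also have "\<dots> < \<infinity>"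
    using int by (simp add: integrable_iff_bounded)
  finally show ?thesis .
qed

lemma weight_measure_emeasure:
  assumes "weight (u :: real ^ 'n \<Rightarrow> real)" "A \<in> sets lebesgue"
  shows "weight_measure u A = emeasure (density lebesgue (\<lambda>x. ennreal (u x))) A"
  unfolding weight_measure_def using assms weight_measurable[OF assms(1)]
  by (subst emeasure_density) auto

lemma weight_measure_SUP:
  assumes "weight (u :: real ^ 'n \<Rightarrow> real)" "incseq A" "\<And>n::nat. A n \<in> sets lebesgue"
  shows "weight_measure u (\<Union>n. A n) = (SUP n. weight_measure u (A n))"
proof -
  have "weight_measure u (\<Union>n. A n) = emeasure (density lebesgue (\<lambda>x. ennreal (u x))) (\<Union>n. A n)"
    using assms by (intro weight_measure_emeasure) auto
  also have "\<dots> = (SUP n. weight_measure u (A n))"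
    using assms(2,3) by (subst SUP_emeasure_incseq[symmetric]) (auto simp: weight_measure_emeasure[OF assms(1)])
  finally show ?thesis .
qed

section \<open>The weak functional in terms of the distribution function\<close>

lemma le_rearr:
  assumes "ennreal t < distr_fun u F z"
  shows "ennreal z \<le> rearr u F t"
  unfolding rearr_def
proof (rule INF_greatest)
  fix s assume s: "s \<in> {s. 0 < s \<and> distr_fun u F s \<le> ennreal t}"
  have "distr_fun u F z \<le> distr_fun u F s" if "s \<le> z"
    unfolding distr_fun_def using that
    by (intro weight_measure_mono) (auto intro: le_less_trans ennreal_leI)
  then have "z \<le> s" using s assms by force
  then show "ennreal z \<le> ennreal s" by (rule ennreal_leI)
qed

text \<open>Removes the rearrangement: the supremum over times \<open>t\<close> becomes one over
  levels \<open>z\<close>. All weak estimates below are stated in this form.\<close>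

lemma weak_norm_bound_iff:
  fixes u :: "real ^ 'n \<Rightarrow> real"
  assumes w: "set_borel_measurable lebesgue {0<..} w" and p: "0 < p"
  shows "weak_lorentz_norm u w p F \<le> C \<longleftrightarrow>
    (\<forall>z>0. ennreal z * epow (primitive w (distr_fun u F z)) (1 / p) \<le> C)"
proof (intro iffI allI impI)
  fix z :: real
  assume C: "weak_lorentz_norm u w p F \<le> C" and z: "0 < z"
  \<comment> \<open>The measure of the level set may be infinite and the rearrangement at that time
    may be below \<open>z\<close>. For each smaller \<open>t\<close>, however,
    \<open>le_rearr\<close> applies, and \<open>primitive_leI\<close> passes to the limit.\<close>
  have "primitive w (distr_fun u F z) \<le> epow (C / ennreal z) p"
  proof (rule primitive_leI[OF w])
    fix t assume t: "t < distr_fun u F z"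
    show "primitive w t \<le> epow (C / ennreal z) p"
    proof (cases "t = 0")
      case False
      moreover have "t \<noteq> top"
        using t top.extremum_strict[of "distr_fun u F z"] by auto
      ultimately have r: "t = ennreal (enn2real t)" "0 < enn2real t"
        using False by (auto simp: enn2real_positive_iff less_top zero_less_iff_neq_zero)
      define r where "r = enn2real t"
      note r = r[folded r_def]
      have "ennreal z \<le> rearr u F r"
        using t r(1) by (intro le_rearr) simp
      then have "epow (primitive w t) (1 / p) * ennreal z \<le> epow (primitive w t) (1 / p) * rearr u F r"
        by (rule mult_left_mono) simp
      also have "\<dots> \<le> weak_lorentz_norm u w p F"
        unfolding weak_lorentz_norm_def using r by (subst r(1), intro SUP_upper) auto
      finally have "epow (primitive w t) (1 / p) \<le> C / ennreal z"
        using C z by (simp add: le_divide_ennreal_iff mult.commute)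
      then show ?thesis using p by (simp add: epow_le_iff[of "1 / p"])
    qed simp
  qed
  then have "epow (primitive w (distr_fun u F z)) (1 / p) \<le> C / ennreal z"
    using p by (simp add: epow_le_iff)
  then show "ennreal z * epow (primitive w (distr_fun u F z)) (1 / p) \<le> C"
    using z by (simp add: le_divide_ennreal_iff)
next
  assume *: "\<forall>z>0. ennreal z * epow (primitive w (distr_fun u F z)) (1 / p) \<le> C"
  show "weak_lorentz_norm u w p F \<le> C"
    unfolding weak_lorentz_norm_def
  proof (rule SUP_least)
    fix t :: real assume t: "t \<in> {0<..}"
    let ?W = "epow (primitive w (ennreal t)) (1 / p)"
    have le: "?W * ennreal z \<le> C" if z: "0 < z" "ennreal z < rearr u F t" for z
    proof -
      have "\<not> distr_fun u F z \<le> ennreal t"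
      proof
        assume "distr_fun u F z \<le> ennreal t"
        then have "rearr u F t \<le> ennreal z"
          unfolding rearr_def using z by (intro INF_lower) auto
        then show False using z by auto
      qed
      then have "?W \<le> epow (primitive w (distr_fun u F z)) (1 / p)"
        using p by (intro epow_mono primitive_mono) auto
      then show ?thesis
        using *[rule_format, OF z(1)] by (metis mult.commute mult_right_mono order_trans zero_le)
    qed
    \<comment> \<open>The rearrangement may be infinite and its distribution function is controlled
      only at smaller levels, so it is approached by finite \<open>y\<close> from below.\<close>
    have "?W * y \<le> C" if y: "y < rearr u F t" for y
    proof (cases y)
      case (real r)
      then show ?thesis using le[of r] y by (cases "r = 0") auto
    qed (use y in auto)
    then have "(SUP y\<in>{..<rearr u F t}. ?W * y) \<le> C" by (intro SUP_least) auto
    then show "?W * rearr u F t \<le> C"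
      using SUP_mult_left_ennreal[of ?W "\<lambda>y. y" "{..<rearr u F t}"] by simp
  qed
qed

section \<open>Superlevel sets of the maximal function\<close>

lemma cubeE:
  assumes "cube (Q :: (real ^ 'n) set)"
  obtains a r where "0 < r" "Q = cbox a (a + r *\<^sub>R One)"
  using assms by (auto simp: cube_def)

lemma emeasure_cube:
  fixes a :: "real ^ 'n"
  assumes "0 \<le> r"
  shows "emeasure lebesgue (cbox a (a + r *\<^sub>R One)) = ennreal (r ^ DIM(real ^ 'n))"
proof -
  have "emeasure lborel (cbox a (a + r *\<^sub>R One)) = ennreal (\<Prod>b\<in>(Basis :: (real ^ 'n) set). r)"
    using assms by (subst emeasure_lborel_cbox) (auto simp: inner_simps intro!: prod.cong)
  then show ?thesis by simp
qed

lemma cube_emeasure_pos: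
  assumes "cube (Q :: (real ^ 'n) set)"
  obtains q where "0 < q" "emeasure lebesgue Q = ennreal q"
proof -
  obtain a r where "0 < r" "Q = cbox a (a + r *\<^sub>R One)"
    using assms by (rule cubeE)
  then show ?thesis
    using that[of "r ^ DIM(real ^ 'n)"] by (simp add: emeasure_cube del: emeasure_completion)
qed

text \<open>As a simp rule it would replace \<open>emeasure lebesgue\<close> by the
  \<open>lborel\<close> measure of a main part, while all volumes below stay in terms of
  \<open>lebesgue\<close>.\<close>

declare emeasure_completion [simp del]

lemma cube_compact: "cube Q \<Longrightarrow> compact Q"
  by (auto simp: cube_def)

lemma cube_sets [measurable_dest, simp]: "cube Q \<Longrightarrow> Q \<in> sets lebesgue"
  by (auto simp: cube_def)

abbreviation average :: "(real ^ 'n \<Rightarrow> complex) \<Rightarrow> (real ^ 'n) set \<Rightarrow> ennreal" where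
  "average f Q \<equiv> (\<integral>\<^sup>+y\<in>Q. ennreal (cmod (f y)) \<partial>lebesgue) / emeasure lebesgue Q"

lemma average_le_maximal: "cube Q \<Longrightarrow> x \<in> Q \<Longrightarrow> average f Q \<le> maximal f x"
  unfolding maximal_def by (rule SUP_upper) simp

text \<open>Enlarging a cube does not decrease the integral and changes the volume continuously.\<close>

lemma average_enlarge:
  fixes x :: "real ^ 'n"
  assumes Q: "cube Q" "x \<in> Q" and s: "ennreal s < average f Q"
  obtains Q' where "cube Q'" "x \<in> interior Q'" "ennreal s < average f Q'"
proof -
  obtain a r where r: "0 < r" "Q = cbox a (a + r *\<^sub>R One)"
    using Q(1) by (rule cubeE)
  define N where "N = DIM(real ^ 'n)"
  define I where "I = (\<integral>\<^sup>+y\<in>Q. ennreal (cmod (f y)) \<partial>lebesgue)"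
  define P where "P d = cbox (a - d *\<^sub>R One) ((a - d *\<^sub>R One) + (r + 2 * d) *\<^sub>R One)" for d
  have P: "emeasure lebesgue (P d) = ennreal ((r + 2 * d) ^ N)" if "0 < d" for d
    unfolding P_def N_def using that r by (intro emeasure_cube) auto
  have "((\<lambda>d. ennreal s * ennreal ((r + 2 * d) ^ N)) \<longlongrightarrow> ennreal s * ennreal ((r + 2 * 0) ^ N)) (at_right 0)"
    by (intro ennreal_tendsto_cmult tendsto_ennrealI tendsto_intros) simp
  moreover have "ennreal s * ennreal ((r + 2 * 0) ^ N) < I"
    using s r unfolding I_def r(2) N_def
    by (simp add: emeasure_cube less_divide_ennreal_iff mult.commute)
  ultimately have "\<forall>\<^sub>F d in at_right 0. ennreal s * ennreal ((r + 2 * d) ^ N) < I"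
    by (rule order_tendstoD)
  then obtain b where "0 < b" "\<And>d. 0 < d \<Longrightarrow> d < b \<Longrightarrow> ennreal s * ennreal ((r + 2 * d) ^ N) < I"
    by (auto simp: eventually_at_right_field)
  then obtain d where d: "0 < d" "ennreal s * ennreal ((r + 2 * d) ^ N) < I"
    using field_lbound_gt_zero[of b b] by auto
  have "Q \<subseteq> P d"
  proof
    fix y assume "y \<in> Q"
    then have "a \<bullet> b \<le> y \<bullet> b \<and> y \<bullet> b \<le> a \<bullet> b + r" if "b \<in> Basis" for b
      using that r by (auto simp: mem_box inner_simps)
    then show "y \<in> P d"
      using d(1) by (fastforce simp: P_def mem_box inner_simps)
  qed
  then have "I \<le> (\<integral>\<^sup>+y\<in>P d. ennreal (cmod (f y)) \<partial>lebesgue)"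
    unfolding I_def by (intro nn_integral_mono) (auto split: split_indicator)
  then have "ennreal s < average f (P d)"
    using d r by (simp add: P less_divide_ennreal_iff mult.commute)
  moreover have "cube (P d)"
    unfolding cube_def P_def using d r by (intro exI[of _ "a - d *\<^sub>R One"] exI[of _ "r + 2 * d"]) auto
  moreover have "x \<in> interior (P d)"
    using Q(2) d r by (fastforce simp: P_def mem_box interior_cbox inner_simps)
  ultimately show ?thesis using that by blast
qed

text \<open>Enlarging puts each point of the superlevel set into the interior of a cube with large
  average, and the Lindelof property selects countably many of these interiors. The closed cubes
  themselves still lie in the superlevel set, so they may replace their interiors.\<close>

lemma maximal_superlevel_cubes:
  fixes f :: "real ^ 'n \<Rightarrow> complex"
  obtains D where "countable D" "\<And>Q. Q \<in> D \<Longrightarrow> cube Q \<and> ennreal s < average f Q"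
    "{x. ennreal s < maximal f x} = \<Union>D"
proof -
  define G where "G = {Q. cube Q \<and> ennreal s < average f Q}"
  have sub: "\<Union>G \<subseteq> {x. ennreal s < maximal f x}"
    using average_le_maximal[of _ _ f] by (auto simp: G_def intro: less_le_trans)
  have int: "{x. ennreal s < maximal f x} \<subseteq> \<Union>(interior ` G)"
  proof
    fix x assume "x \<in> {x. ennreal s < maximal f x}"
    then obtain Q where "cube Q" "x \<in> Q" "ennreal s < average f Q"
      by (auto simp: maximal_def less_SUP_iff)
    then obtain Q' where "cube Q'" "x \<in> interior Q'" "ennreal s < average f Q'"
      by (rule average_enlarge)
    then show "x \<in> \<Union>(interior ` G)" by (auto simp: G_def)
  qed
  obtain F where F: "F \<subseteq> interior ` G" "countable F" "\<Union>F = \<Union>(interior ` G)"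
    using Lindelof[of "interior ` G"] by auto
  then obtain D where D: "countable D" "D \<subseteq> G" "F = interior ` D"
    by (metis countable_subset_image)
  have "\<Union>(interior ` D) \<subseteq> \<Union>D"
    using interior_subset by blast
  then have "{x. ennreal s < maximal f x} = \<Union>D"
    using int sub F(3) D(3) Union_mono[OF D(2)] by (intro antisym) auto
  then show ?thesis
    using D by (intro that[of D]) (auto simp: G_def)
qed

lemma maximal_measurable:
  fixes f :: "real ^ 'n \<Rightarrow> complex"
  shows "maximal f \<in> borel_measurable lebesgue"
proof (rule borel_measurableI_greater)
  fix y :: ennreal
  show "{x \<in> space lebesgue. y < maximal f x} \<in> sets lebesgue"
  proof (cases y)
    case (real s)
    obtain D where D: "countable D" "\<And>Q. Q \<in> D \<Longrightarrow> cube Q \<and> ennreal s < average f Q"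
      "{x. ennreal s < maximal f x} = \<Union>D"
      by (rule maximal_superlevel_cubes[of s f]) auto
    then show ?thesis using real by (auto intro!: sets.countable_Union)
  qed simp
qed

text \<open>Countable sublinearity: average the pointwise bound over a cube. Integral and sum may be
  exchanged as all terms are nonnegative, and the average of the constant \<open>c\<close> is
  \<open>c\<close>.\<close>

lemma maximal_le_suminf:
  fixes f :: "real ^ 'n \<Rightarrow> complex"
  assumes g: "\<And>k. g k \<in> borel_measurable lebesgue"
    and le: "\<And>y. ennreal (cmod (f y)) \<le> c + (\<Sum>k::nat. a k * ennreal (cmod (g k y)))"
  shows "maximal f x \<le> c + (\<Sum>k. a k * maximal (g k) x)"
  unfolding maximal_def[of f]
proof (rule SUP_least)
  fix Q assume "Q \<in> {Q. cube Q \<and> x \<in> Q}"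
  then have Q: "cube Q" "x \<in> Q" by auto
  note [measurable] = g cube_sets[OF Q(1)]
  obtain q where q: "0 < q" "emeasure lebesgue Q = ennreal q"
    using Q(1) by (rule cube_emeasure_pos)
  have "(\<integral>\<^sup>+y\<in>Q. ennreal (cmod (f y)) \<partial>lebesgue)
      \<le> (\<integral>\<^sup>+y. c * indicator Q y + (\<Sum>k. a k * (ennreal (cmod (g k y)) * indicator Q y)) \<partial>lebesgue)"
    using le by (intro nn_integral_mono) (auto split: split_indicator)
  also have "\<dots> = c * emeasure lebesgue Q + (\<Sum>k. a k * (\<integral>\<^sup>+y\<in>Q. ennreal (cmod (g k y)) \<partial>lebesgue))"
    by (simp add: nn_integral_add nn_integral_suminf nn_integral_cmult nn_integral_cmult_indicator)
  finally have "average f Q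
      \<le> (c * emeasure lebesgue Q + (\<Sum>k. a k * (\<integral>\<^sup>+y\<in>Q. ennreal (cmod (g k y)) \<partial>lebesgue))) / emeasure lebesgue Q"
    by (rule divide_right_mono_ennreal)
  also have "\<dots> = c + (\<Sum>k. a k * average (g k) Q)"
    using q by (simp add: add_divide_distrib_ennreal ennreal_mult_divide_eq ennreal_times_divide)
  also have "\<dots> \<le> c + (\<Sum>k. a k * maximal (g k) x)"
    using average_le_maximal[OF Q] by (intro add_left_mono suminf_le mult_left_mono) auto
  finally show "average f Q \<le> c + (\<Sum>k. a k * maximal (g k) x)" .
qed

section \<open>The cube condition and the restricted weak type inequality\<close>

lemma average_indicator:
  fixes E :: "(real ^ 'n) set"
  assumes "E \<in> sets lebesgue" "Q \<in> sets lebesgue"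
  shows "average (indicator E) Q = emeasure lebesgue (E \<inter> Q) / emeasure lebesgue Q"
proof -
  have "(\<integral>\<^sup>+y\<in>Q. ennreal (cmod (indicator E y)) \<partial>lebesgue) = (\<integral>\<^sup>+y. indicator (E \<inter> Q) y \<partial>lebesgue)"
    by (intro nn_integral_cong) (auto split: split_indicator)
  then show ?thesis using assms by simp
qed

text \<open>The constant is a parameter, so that both implications of the theorem can speak about a
  given \<open>C\<close>. The bound \<open>1 \<le> J\<close> keeps the maximum over a nonempty
  set.\<close>

definition cube_condition ::
  "(real ^ 'n \<Rightarrow> real) \<Rightarrow> (real \<Rightarrow> real) \<Rightarrow> real \<Rightarrow> (real ^ 'n \<Rightarrow> real) \<Rightarrow> (real \<Rightarrow> real) \<Rightarrow> real \<Rightarrow> ennreal \<Rightarrow> bool"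
where
  "cube_condition u0 w0 p0 u1 w1 p1 C \<longleftrightarrow> (\<forall>(J::nat) (Q :: nat \<Rightarrow> (real ^ 'n) set) (E :: nat \<Rightarrow> (real ^ 'n) set).
       1 \<le> J \<longrightarrow> (\<forall>j\<in>{1..J}. cube (Q j)) \<longrightarrow>
       (\<forall>j\<in>{1..J}. E j \<in> sets lebesgue \<and> E j \<subseteq> Q j) \<longrightarrow>
       epow (primitive w1 (weight_measure u1 (\<Union>j\<in>{1..J}. Q j))) (1 / p1)
         / epow (primitive w0 (weight_measure u0 (\<Union>j\<in>{1..J}. E j))) (1 / p0)
       \<le> C * (MAX j\<in>{1..J}. emeasure lebesgue (Q j) / emeasure lebesgue (E j)))"

lemma weight_pos_primitive_finite:
  assumes "weight_pos u w" "t < \<infinity>"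
  shows "primitive w t < \<infinity>"
  using assms by (cases t) (auto simp: weight_pos_def)

lemma epow_less_top: "x < top \<Longrightarrow> epow x p < top"
  by (cases x) (auto simp: epow_ennreal)

text \<open>A cube \<open>Q\<close> from the superlevel set of level \<open>s\<close> satisfies
  \<open>|Q| / |E \<inter> Q| \<le> 1 / s\<close>, so the condition bounds every finite union of
  such cubes. Left continuity of the primitive extends the bound to their countable union.\<close>

lemma restricted_weak_type:
  fixes u0 u1 :: "real ^ 'n \<Rightarrow> real"
  assumes u: "weight u0" "weight u1" and w: "weight_pos u0 w0" "weight_pos u1 w1"
    and p: "0 < p0" "0 < p1" and C: "C < \<infinity>" "cube_condition u0 w0 p0 u1 w1 p1 C"
    and E: "E \<in> sets lebesgue" and s: "0 < s"
  shows "ennreal s * epow (primitive w1 (distr_fun u1 (maximal (indicator E)) s)) (1 / p1)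
    \<le> C * epow (primitive w0 (weight_measure u0 E)) (1 / p0)"
proof -
  let ?R = "C * epow (primitive w0 (weight_measure u0 E)) (1 / p0)"
  have w1: "set_borel_measurable lebesgue {0<..} w1" using w(2) by (simp add: weight_pos_def)
  obtain D where D: "countable D" "\<And>Q. Q \<in> D \<Longrightarrow> cube Q \<and> ennreal s < average (indicator E) Q"
      "{x. ennreal s < maximal (indicator E) x} = \<Union>D"
    by (rule maximal_superlevel_cubes[of s "indicator E"]) auto
  show ?thesis
  proof (cases "D = {}")
    case True
    then show ?thesis using D(3) by (simp add: distr_fun_def weight_measure_def)
  next
    case False
    define Q where "Q = from_nat_into D"
    have DQ: "\<Union>D = (\<Union>n. Q n)"
      using D(1) False by (simp add: Q_def range_from_nat_into)
    have Q: "cube (Q n)" "ennreal s < average (indicator E) (Q n)" for n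
      using D(2) from_nat_into[OF False] by (auto simp: Q_def)
    have inv_s: "1 / ennreal s = ennreal (1 / s)"
      using divide_ennreal[of 1 s] s by simp
    \<comment> \<open>The enumeration of the cubes starts at 0, but families in
      \<open>cube_condition\<close> are indexed from 1; hence \<open>j - 1\<close> and
      \<open>Suc J\<close>.\<close>
    define U where "U J = (\<Union>j\<in>{1..Suc J}. Q (j - 1))" for J
    have UJ: "epow (primitive w1 (weight_measure u1 (U J))) (1 / p1) \<le> ?R / ennreal s" for J
    proof -
      define V where "V = (\<Union>j\<in>{1..Suc J}. E \<inter> Q (j - 1))"
      define B where "B = epow (primitive w0 (weight_measure u0 V)) (1 / p0)"
      have ratio: "emeasure lebesgue (Q n) / emeasure lebesgue (E \<inter> Q n) \<le> 1 / ennreal s" for n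
      proof -
        obtain q where q: "0 < q" "emeasure lebesgue (Q n) = ennreal q"
          using Q(1) by (rule cube_emeasure_pos)
        have "emeasure lebesgue (E \<inter> Q n) \<le> ennreal q"
          unfolding q(2)[symmetric] using Q(1) by (intro emeasure_mono) auto
        then obtain e where e: "emeasure lebesgue (E \<inter> Q n) = ennreal e" "0 \<le> e"
          by (cases "emeasure lebesgue (E \<inter> Q n)") (auto simp: top_unique)
        have "ennreal s < ennreal e / ennreal q"
          using Q(2)[of n] unfolding average_indicator[OF E cube_sets[OF Q(1)]] unfolding q e .
        then have "s < e / q"
          using q e s by (simp add: divide_ennreal ennreal_less_iff)
        then have *: "s * q < e"
          using q by (simp add: pos_less_divide_eq)
        moreover have "0 < s * q" using s q by simp
        ultimately have "0 < e" by linarith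
        with * have "q / e \<le> 1 / s"
          using s by (simp add: divide_le_eq le_divide_eq mult.commute)
        then show ?thesis
          using q s \<open>0 < e\<close> unfolding e(1) q(2) inv_s by (simp add: divide_ennreal ennreal_leI)
      qed
      \<comment> \<open>\<open>V\<close> is bounded, so the denominator \<open>B\<close> below is
        finite and the quotient can be cleared.\<close>
      have "V \<subseteq> (\<Union>j\<in>{1..Suc J}. Q (j - 1))" by (auto simp: V_def)
      then have "weight_measure u0 V < \<infinity>"
        by (rule weight_measure_finite[OF u(1)]) (intro compact_UN cube_compact Q(1) finite_atLeastAtMost)
      then have B: "B < \<infinity>"
        unfolding B_def using weight_pos_primitive_finite[OF w(1)] by (auto intro: epow_less_top)
      have "epow (primitive w1 (weight_measure u1 (U J))) (1 / p1) / B
          \<le> C * (MAX j\<in>{1..Suc J}. emeasure lebesgue (Q (j - 1)) / emeasure lebesgue (E \<inter> Q (j - 1)))"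
        using C(2)[unfolded cube_condition_def, rule_format, of "Suc J" "\<lambda>j. Q (j - 1)" "\<lambda>j. E \<inter> Q (j - 1)"]
          Q(1) E by (auto simp: U_def V_def B_def)
      also have "\<dots> \<le> C * (1 / ennreal s)"
        using ratio by (intro mult_left_mono) (auto simp: Max_le_iff)
      finally have "epow (primitive w1 (weight_measure u1 (U J))) (1 / p1) \<le> C * (1 / ennreal s) * B"
        using B C(1) by (elim divide_le_imp_le_mult_ennreal) (auto simp: inv_s ennreal_mult_less_top)
      also have "\<dots> \<le> C * (1 / ennreal s) * epow (primitive w0 (weight_measure u0 E)) (1 / p0)"
        unfolding B_def using p
        by (intro mult_left_mono epow_mono primitive_mono weight_measure_mono) (auto simp: V_def)
      finally show ?thesis
        by (simp add: ennreal_times_divide ennreal_divide_times)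

    qed
    have inc: "incseq U" by (force simp: U_def incseq_def)
    have "(\<Union>n. Q n) = (\<Union>J. U J)"
    proof (intro equalityI subsetI)
      fix x assume "x \<in> (\<Union>n. Q n)"
      then obtain n where "x \<in> Q n" by auto
      then have "x \<in> U n" by (auto simp: U_def intro!: bexI[of _ "Suc n"])
      then show "x \<in> (\<Union>J. U J)" by auto
    qed (auto simp: U_def)
    then have "distr_fun u1 (maximal (indicator E)) s = (SUP J. weight_measure u1 (U J))"
      unfolding distr_fun_def D(3) DQ
      using weight_measure_SUP[OF u(2) inc] Q(1) by (auto simp: U_def)
    moreover have "incseq (\<lambda>J. weight_measure u1 (U J))"
      using inc by (auto simp: incseq_def intro: weight_measure_mono)
    ultimately have "primitive w1 (distr_fun u1 (maximal (indicator E)) s)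
        = (SUP J. primitive w1 (weight_measure u1 (U J)))"
      by (simp add: primitive_SUP[OF w1])
    also have "\<dots> \<le> epow (?R / ennreal s) p1"
      using UJ p by (intro SUP_least) (simp add: epow_le_iff[of "1 / p1"])
    finally have "epow (primitive w1 (distr_fun u1 (maximal (indicator E)) s)) (1 / p1) \<le> ?R / ennreal s"
      using p by (simp add: epow_le_iff)
    then show ?thesis using s by (simp add: le_divide_ennreal_iff)
  qed
qed

section \<open>Growth of the primitive of a weight in the Hardy class\<close>

lemma hardy_indicator:
  assumes "0 < r" "0 < t"
  shows "hardy (indicator {..<r}) t = ennreal (min 1 (r / t))"
proof -
  have "(\<integral>\<^sup>+s\<in>{0<..<t}. ennreal (indicator {..<r} s) \<partial>lebesgue) = (\<integral>\<^sup>+s. indicator {0<..<min r t} s \<partial>lebesgue)"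
    by (intro nn_integral_cong) (auto split: split_indicator)
  also have "\<dots> = ennreal (min r t)"
    using assms by (simp add: emeasure_completion)
  finally show ?thesis
    using assms by (auto simp: hardy_def divide_ennreal min_def)
qed

text \<open>Testing the Hardy inequality on indicator functions shows that the integral \<open>V r\<close> of
  \<open>min 1 (r / t) powr q * w t\<close> over \<open>t > 0\<close> is comparable to the primitive of \<open>w\<close> at \<open>r\<close>, while
  \<open>r powr - q * V r\<close> drops by a definite factor \<open>\<sigma> powr q\<close> when \<open>r\<close> doubles.\<close>

lemma B_class_growth:
  assumes w: "w \<in> B_class q" "weight_pos u w" and q: "0 < q"
  obtains K \<sigma> where "1 \<le> K" "1 / 2 \<le> \<sigma>" "\<sigma> < 1"
    "\<And>t k. 0 < t \<Longrightarrow> primitive w (ennreal t)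
       \<le> ennreal ((K * (2 * \<sigma>) ^ k) powr q) * primitive w (ennreal (t / 2 ^ k))"
proof -
  have meas [measurable]: "(\<lambda>s. ennreal (w s) * indicator {0<..} s) \<in> borel_measurable lebesgue"
    using w(2) by (intro measurable_pos_part) (simp add: weight_pos_def)
  have meas_min [measurable]: "(\<lambda>t. ennreal (min 1 (r / t) powr q)) \<in> borel_measurable lebesgue" for r
  proof -
    have "(\<lambda>t. ennreal (min 1 (r / t) powr q)) \<in> borel_measurable lborel" by measurable
    then show ?thesis by (rule measurable_completion)
  qed
  define W where "W t = primitive w (ennreal t)" for t
  define V where "V r = (\<integral>\<^sup>+t. ennreal (min 1 (r / t) powr q) * (ennreal (w t) * indicator {0<..} t) \<partial>lebesgue)" for r
  obtain C where C: "C < \<infinity>" "\<And>g. (\<forall>s>0. 0 \<le> g s) \<and> antimono_on {0<..} g \<Longrightarrow>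
      Lq_norm w q (hardy g) \<le> C * Lq_norm w q (\<lambda>s. ennreal (g s))"
    using w(1) by (auto simp: B_class_def)
  \<comment> \<open>A real constant that is at least 1: this yields \<open>c \<le> 1 - a\<close>
    below, hence \<open>1 / 2 \<le> \<sigma>\<close>, and also \<open>1 \<le> K\<close>.\<close>
  define C' where "C' = max 1 (enn2real (epow C q))"
  have C': "1 \<le> C'" "epow C q \<le> ennreal C'"
  proof -
    have "epow C q = ennreal (enn2real (epow C q))"
      using C(1) epow_less_top[of C q] by simp
    also have "\<dots> \<le> ennreal C'"
      unfolding C'_def by (intro ennreal_leI) simp
    finally show "epow C q \<le> ennreal C'" .
  qed (simp add: C'_def)
  have W_fin: "W t < top" for t
    using weight_pos_primitive_finite[OF w(2)] by (simp add: W_def)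
  have VW: "V r \<le> ennreal C' * W r" if r: "0 < r" for r
  proof -
    have "Lq_norm w q (hardy (indicator {..<r})) \<le> C * Lq_norm w q (\<lambda>s. ennreal (indicator {..<r} s))"
      by (intro C(2)) (auto simp: monotone_on_def split: split_indicator)
    moreover have "Lq_norm w q (hardy (indicator {..<r})) = epow (V r) (1 / q)"
      unfolding Lq_norm_def V_def using r
      by (intro arg_cong2[where f = epow] nn_integral_cong)
        (auto simp: hardy_indicator epow_ennreal split: split_indicator)
    moreover have "Lq_norm w q (\<lambda>s. ennreal (indicator {..<r} s)) = epow (W r) (1 / q)"
      unfolding Lq_norm_def W_def primitive_eq using r
      by (intro arg_cong2[where f = epow] nn_integral_cong)
        (auto simp: ennreal_less_iff split: split_indicator)
    ultimately have "epow (V r) (1 / q) \<le> C * epow (W r) (1 / q)"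
      by simp
    then have "V r \<le> epow (C * epow (W r) (1 / q)) q"
      using q by (simp add: epow_le_iff[of "1 / q"])
    also have "\<dots> = epow C q * W r"
      using q by (simp add: epow_mult epow_inverse)
    also have "\<dots> \<le> ennreal C' * W r"
      using C' by (intro mult_right_mono) auto
    finally show ?thesis .
  qed
  have WV: "W r \<le> V r" if "0 < r" for r
    unfolding W_def V_def primitive_eq
  proof (intro nn_integral_mono)
    fix s show "ennreal (w s) * indicator {0<..} s * indicator {s. ennreal s < ennreal r} s
      \<le> ennreal (min 1 (r / s) powr q) * (ennreal (w s) * indicator {0<..} s)"
      using that by (auto simp: ennreal_less_iff min_def field_simps split: split_indicator)
  qed
  have V_fin: "V r < top" if "0 < r" for r
    using VW[OF that] W_fin[of r] by (auto simp: ennreal_mult_less_top intro: le_less_trans)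
  define a where "a = (1 / 2 :: real) powr q"
  have a: "0 < a" "a < 1"
    using q powr_less_mono2[of q "1 / 2" 1] by (auto simp: a_def)
  \<comment> \<open>This holds under the integral. For \<open>t < r\<close> both sides have factor
    1; for \<open>t \<ge> r\<close> it holds because half of \<open>min 1 (2 * r / t)\<close> is at
    most \<open>min 1 (r / t)\<close> and \<open>a\<close> is the \<open>q\<close>-th power of
    1/2.\<close>
  have step: "ennreal a * V (2 * r) + ennreal (1 - a) * W r \<le> V r" if r: "0 < r" for r
  proof -
    have "ennreal a * V (2 * r) + ennreal (1 - a) * W r
      = (\<integral>\<^sup>+t. ennreal a * (ennreal (min 1 (2 * r / t) powr q) * (ennreal (w t) * indicator {0<..} t))
          + ennreal (1 - a) * (ennreal (w t) * indicator {0<..} t * indicator {s. ennreal s < ennreal r} t) \<partial>lebesgue)"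
      unfolding V_def W_def primitive_eq 
      by (subst (1 2) nn_integral_cmult[symmetric], measurable, subst nn_integral_add, measurable)
    also have "\<dots> \<le> V r"
      unfolding V_def
    proof (intro nn_integral_mono)
      fix t
      show "ennreal a * (ennreal (min 1 (2 * r / t) powr q) * (ennreal (w t) * indicator {0<..} t))
          + ennreal (1 - a) * (ennreal (w t) * indicator {0<..} t * indicator {s. ennreal s < ennreal r} t)
        \<le> ennreal (min 1 (r / t) powr q) * (ennreal (w t) * indicator {0<..} t)"
      proof (cases "0 < t")
        case True
        have "a * min 1 (2 * r / t) powr q + (1 - a) * indicator {s. s < r} t \<le> min 1 (r / t) powr q"
        proof (cases "t < r")
          case True
          then show ?thesis using \<open>0 < t\<close> r by (simp add: min_def field_simps)
        next
          case False
          then have "a * min 1 (2 * r / t) powr q = (1 / 2 * min 1 (2 * r / t)) powr q"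
            unfolding a_def using r \<open>0 < t\<close> by (subst powr_mult) auto
          also have "\<dots> \<le> min 1 (r / t) powr q"
            using q r \<open>0 < t\<close> False by (intro powr_mono2) (auto simp: min_def field_simps)
          finally show ?thesis using False by simp
        qed
        then have "ennreal (a * min 1 (2 * r / t) powr q + (1 - a) * indicator {s. s < r} t) * ennreal (w t)
           \<le> ennreal (min 1 (r / t) powr q) * ennreal (w t)"
          by (intro mult_right_mono ennreal_leI) auto
        moreover have "ennreal (a * min 1 (2 * r / t) powr q + (1 - a) * indicator {s. s < r} t)
          = ennreal a * ennreal (min 1 (2 * r / t) powr q)
            + ennreal (1 - a) * indicator {s. ennreal s < ennreal r} t"
          using True a r
          by (subst ennreal_plus) (auto simp: ennreal_mult ennreal_less_iff split: split_indicator)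
        moreover have "indicator {0<..} t = (1 :: ennreal)"
          using True by simp
        ultimately show ?thesis
          by (simp only: distrib_right mult_1_right mult.assoc mult.commute[of "ennreal (w t)"])
      qed simp
    qed
    finally show ?thesis .
  qed
  \<comment> \<open>By \<open>VW\<close>, the term \<open>(1 - a) * W r\<close> in
    \<open>step\<close> is at least \<open>c * V r\<close>, which leaves
    \<open>a * V (2 * r) \<le> (1 - c) * V r\<close>. The number \<open>\<sigma>\<close> is chosen
    so that \<open>(1 - c) / a\<close> becomes \<open>(2 * \<sigma>) powr q\<close>.\<close>
  define c where "c = (1 - a) / C'"
  have c: "0 < c" "c \<le> 1 - a"
    using a C' divide_left_mono[of 1 C' "1 - a"] by (auto simp: c_def)
  then have c1: "c < 1" using a by simp
  define \<sigma> where "\<sigma> = (1 - c) powr (1 / q)"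
  have \<sigma>0: "0 \<le> \<sigma>" by (simp add: \<sigma>_def)
  have "a powr (1 / q) \<le> \<sigma>"
    unfolding \<sigma>_def using a c q by (intro powr_mono2) auto
  moreover have "a powr (1 / q) = 1 / 2"
    using q by (simp add: a_def powr_powr)
  moreover have "\<sigma> < 1"
    unfolding \<sigma>_def using a c q powr_less_mono2[of "1 / q" "1 - c" 1] by simp
  moreover have double: "V (2 * r) \<le> ennreal ((2 * \<sigma>) powr q) * V r" if r: "0 < r" for r
  proof -
    obtain v v2 y where v: "V r = ennreal v" "V (2 * r) = ennreal v2" "W r = ennreal y" "0 \<le> v" "0 \<le> v2" "0 \<le> y"
      using V_fin[of r] V_fin[of "2 * r"] W_fin[of r] r
      by (cases "V r"; cases "V (2 * r)"; cases "W r") auto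
    have "a * v2 + (1 - a) * y \<le> v"
      using step[OF r] a v by (simp flip: ennreal_mult ennreal_plus)
    moreover have "v \<le> C' * y"
      using VW[OF r] C' v by (simp flip: ennreal_mult)
    then have "c * v \<le> (1 - a) * y"
      using a C' by (simp add: c_def divide_le_eq mult.commute mult_left_mono mult.left_commute)
    ultimately have "a * v2 \<le> (1 - c) * v"
      by (simp add: algebra_simps)
    moreover have "(2 * \<sigma>) powr q = (1 - c) / a"
      using c1 q by (simp add: \<sigma>_def powr_mult powr_powr a_def powr_divide)
    ultimately have "v2 \<le> (2 * \<sigma>) powr q * v"
      using a by (simp add: pos_le_divide_eq mult.commute)
    then have "ennreal v2 \<le> ennreal ((2 * \<sigma>) powr q) * ennreal v"
      using v by (simp add: ennreal_leI flip: ennreal_mult)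
    then show ?thesis by (simp only: v)
  qed
  moreover have "V t \<le> ennreal (((2 * \<sigma>) ^ k) powr q) * V (t / 2 ^ k)" if "0 < t" for t k
  proof (induction k)
    case (Suc k)
    have "V (t / 2 ^ k) \<le> ennreal ((2 * \<sigma>) powr q) * V (t / 2 ^ Suc k)"
      using double[of "t / 2 ^ Suc k"] that by simp
    then have "V t \<le> ennreal (((2 * \<sigma>) ^ k) powr q) * (ennreal ((2 * \<sigma>) powr q) * V (t / 2 ^ Suc k))"
      by (intro order_trans[OF Suc] mult_left_mono) auto
    also have "\<dots> = ennreal (((2 * \<sigma>) ^ Suc k) powr q) * V (t / 2 ^ Suc k)"
      using powr_mult[of "2 * \<sigma>" "(2 * \<sigma>) ^ k" q] \<sigma>0 by (simp add: ennreal_mult mult.commute mult.left_commute)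
    finally show ?case .
  qed simp
  note it = this
  \<comment> \<open>Pass from \<open>W\<close> to \<open>V\<close> at \<open>t\<close>, iterate the
    doubling bound, and return to \<open>W\<close> at \<open>t / 2 ^ k\<close>; the return costs
    \<open>C'\<close>, which gives \<open>K = C' powr (1 / q)\<close>.\<close>
  have "W t \<le> ennreal ((C' powr (1 / q) * (2 * \<sigma>) ^ k) powr q) * W (t / 2 ^ k)" if t: "0 < t" for t k
  proof -
    have "W t \<le> ennreal (((2 * \<sigma>) ^ k) powr q) * V (t / 2 ^ k)"
      using WV[OF t] it[OF t, of k] by (rule order_trans)
    also have "\<dots> \<le> ennreal (((2 * \<sigma>) ^ k) powr q) * (ennreal C' * W (t / 2 ^ k))"
      using VW[of "t / 2 ^ k"] t by (intro mult_left_mono) auto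
    also have "\<dots> = ennreal ((C' powr (1 / q) * (2 * \<sigma>) ^ k) powr q) * W (t / 2 ^ k)"
      using C' q powr_mult[of "C' powr (1 / q)" "(2 * \<sigma>) ^ k" q] \<sigma>0
      by (simp add: powr_powr ennreal_mult mult.assoc mult.commute mult.left_commute)
    finally show ?thesis .
  qed
  moreover have "1 \<le> C' powr (1 / q)"
    using C' q by (intro ge_one_powr_ge_zero) auto
  ultimately show ?thesis
    using that[of "C' powr (1 / q)" \<sigma>] by (simp add: W_def)
qed

section \<open>Countable subadditivity of the weak functional\<close>

abbreviation weight_space :: "(real ^ 'n \<Rightarrow> real) \<Rightarrow> (real ^ 'n) measure" where
  "weight_space u \<equiv> density lebesgue (\<lambda>x. ennreal (u x))"

text \<open>If \<open>j\<close> is the least index with \<open>h \<le> y j\<close>, then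
  \<open>h\<close> is bounded by the leading term when \<open>j = 0\<close> and by the summand of
  index \<open>j - 1\<close> otherwise. If there is no such index, all summands are present and at
  least \<open>y 0 > 0\<close>, so the sum is infinite.\<close>

lemma le_step_function:
  fixes h :: ennreal and y :: "nat \<Rightarrow> real"
  assumes y: "0 < y 0" "\<And>j. y 0 \<le> y j"
  shows "h \<le> ennreal (y 0) + (\<Sum>j. ennreal (y (Suc j)) * of_bool (ennreal (y j) < h))"
proof (cases "\<exists>j. h \<le> ennreal (y j)")
  case True
  define j where "j = (LEAST j. h \<le> ennreal (y j))"
  have j: "h \<le> ennreal (y j)"
    unfolding j_def using True by (rule LeastI_ex)
  have less: "ennreal (y i) < h" if "i < j" for i
    using not_less_Least[OF that[unfolded j_def]] by (simp add: not_le)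
  show ?thesis
  proof (cases j)
    case 0
    then show ?thesis using j by (auto intro: add_increasing2)
  next
    case (Suc i)
    have "(\<Sum>j\<in>{i}. ennreal (y (Suc j)) * of_bool (ennreal (y j) < h))
        \<le> (\<Sum>j. ennreal (y (Suc j)) * of_bool (ennreal (y j) < h))"
      by (intro sum_le_suminf) auto
    then have "h \<le> (\<Sum>j. ennreal (y (Suc j)) * of_bool (ennreal (y j) < h))"
      using j less[of i] Suc by (auto intro: order_trans)
    then show ?thesis by (rule add_increasing[OF zero_le])
  qed
next
  case False
  have "of_nat n * ennreal (y 0) \<le> (\<Sum>j. ennreal (y (Suc j)))" for n
  proof -
    have "of_nat n * ennreal (y 0) = (\<Sum>j<n. ennreal (y 0))" by simp
    also have "\<dots> \<le> (\<Sum>j<n. ennreal (y (Suc j)))"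
      using y by (intro sum_mono ennreal_leI) auto
    also have "\<dots> \<le> (\<Sum>j. ennreal (y (Suc j)))"
      by (intro sum_le_suminf) auto
    finally show ?thesis .
  qed
  then have "(SUP n. of_nat n * ennreal (y 0)) \<le> (\<Sum>j. ennreal (y (Suc j)))"
    by (intro SUP_least)
  moreover have "(SUP n. of_nat n * ennreal (y 0)) = top"
    using y(1) by (simp add: SUP_mult_right_ennreal[symmetric] ennreal_SUP_of_nat_eq_top ennreal_top_mult)
  ultimately show ?thesis
    using False by (simp add: not_le top_unique)
qed

text \<open>Fixes the constants supplied by \<open>B_class_growth\<close>; the Hardy class enters
  the subadditivity argument through \<open>growth\<close> only.\<close>

locale weight_growth =
  fixes u :: "real ^ 'n \<Rightarrow> real" and w :: "real \<Rightarrow> real" and q K \<sigma> :: real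
  assumes u: "weight u" and w: "weight_pos u w" and q: "0 < q"
    and K: "1 \<le> K" and \<sigma>: "1 / 2 \<le> \<sigma>" "\<sigma> < 1"
    and growth: "0 < t \<Longrightarrow> primitive w (ennreal t)
       \<le> ennreal ((K * (2 * \<sigma>) ^ k) powr q) * primitive w (ennreal (t / 2 ^ k))"
begin

text \<open>The value of the geometric series in \<open>weak_integral_bound_pos\<close>:
  \<open>2 * K\<close> comes from the level \<open>y 0\<close>, the remainder from the levels above
  it.\<close>

definition D :: real where
  "D = 2 * K * (1 + 2 * \<sigma> / (1 - \<sigma>))"

lemma D_pos: "0 < D"
  using K \<sigma> by (auto simp: D_def intro!: mult_pos_pos add_pos_nonneg)

text \<open>Along levels \<open>y j\<close> growing like \<open>(2 * \<sigma>) ^ j\<close> the level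
  sets of \<open>h\<close> have measure at most \<open>t / 2 ^ j\<close>. The step function bound
  then sums to a geometric series of ratio \<open>\<sigma> < 1\<close>.\<close>

lemma weak_integral_bound_pos:
  assumes t: "0 < t" and v: "primitive w (ennreal t) = ennreal v" "0 < v"
    and S: "S \<in> sets lebesgue" "weight_measure u S \<le> ennreal t"
    and h: "h \<in> borel_measurable lebesgue" and b: "0 < b"
    and weak: "\<And>z. 0 < z \<Longrightarrow> ennreal z * epow (primitive w (distr_fun u h z)) (1 / q) \<le> ennreal b"
  shows "(\<integral>\<^sup>+x\<in>S. h x \<partial>weight_space u) \<le> ennreal (D * t * v powr (- (1 / q)) * b)"
proof -
  note [measurable] = S(1) h weight_measurable[OF u]
  \<comment> \<open>If \<open>{h > y j}\<close> had measure above \<open>t / 2 ^ j\<close>, then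
    \<open>growth\<close> would give \<open>2 * b \<le> y j * vj powr (1 / q)\<close>, while
    \<open>weak\<close> bounds the right-hand side by \<open>b\<close>. The factor 2 creates this
    gap.\<close>
  define y where "y j = 2 * b * K * v powr (- (1 / q)) * (2 * \<sigma>) ^ j" for j
  define c where "c = 2 * b * K * v powr (- (1 / q))"
  have c: "0 < c" using b K v by (simp add: c_def)
  have y_eq: "y j = c * (2 * \<sigma>) ^ j" for j by (simp add: y_def c_def)
  have y_pos: "0 < y j" for j
    using c \<sigma> by (simp add: y_eq)
  have level: "distr_fun u h (y j) \<le> ennreal (t / 2 ^ j)" for j
  proof (rule ccontr)
    assume "\<not> ?thesis"
    then have le: "primitive w (ennreal (t / 2 ^ j)) \<le> primitive w (distr_fun u h (y j))"
      by (intro primitive_mono) simp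
    obtain vj where vj: "primitive w (ennreal (t / 2 ^ j)) = ennreal vj" "0 \<le> vj"
      using weight_pos_primitive_finite[OF w, of "ennreal (t / 2 ^ j)"]
      by (cases "primitive w (ennreal (t / 2 ^ j))") auto
    have "ennreal v \<le> ennreal ((K * (2 * \<sigma>) ^ j) powr q * vj)"
      using growth[OF t, of j] v vj by (simp add: ennreal_mult)
    then have "v \<le> (K * (2 * \<sigma>) ^ j) powr q * vj"
      using vj by (simp add: ennreal_le_iff)
    then have "v powr (1 / q) \<le> ((K * (2 * \<sigma>) ^ j) powr q * vj) powr (1 / q)"
      using v q by (intro powr_mono2) auto
    also have "\<dots> = K * (2 * \<sigma>) ^ j * vj powr (1 / q)"
      using K \<sigma> q vj by (simp add: powr_mult powr_powr)
    finally have *: "v powr (1 / q) \<le> K * (2 * \<sigma>) ^ j * vj powr (1 / q)" .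
    have "2 * b = 2 * b * v powr (- (1 / q)) * v powr (1 / q)"
      using v by (simp add: powr_minus)
    also have "\<dots> \<le> 2 * b * v powr (- (1 / q)) * (K * (2 * \<sigma>) ^ j * vj powr (1 / q))"
      using * b by (intro mult_left_mono) auto
    also have "\<dots> = y j * vj powr (1 / q)"
      by (simp add: y_def)
    finally have "2 * b \<le> y j * vj powr (1 / q)" .
    moreover have "ennreal (y j) * epow (ennreal vj) (1 / q) \<le> ennreal b"
      using weak[OF y_pos] le q unfolding vj
      by (meson epow_mono mult_left_mono order_trans zero_le zero_less_divide_1_iff)
    then have "y j * vj powr (1 / q) \<le> b"
      using y_pos[of j] vj b by (simp add: epow_ennreal flip: ennreal_mult)
    ultimately show False using b by simp
  qed
  have y0: "y 0 \<le> y j" for j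
    using c \<sigma> one_le_power[of "2 * \<sigma>" j] by (simp add: y_eq)
  have lev [measurable]: "{x. ennreal (y j) < h x} \<in> sets lebesgue" for j
  proof -
    have "{x \<in> space lebesgue. ennreal (y j) < h x} \<in> sets lebesgue" by measurable
    then show ?thesis by simp
  qed
  have "(\<integral>\<^sup>+x\<in>S. h x \<partial>weight_space u)
      \<le> (\<integral>\<^sup>+x. ennreal (y 0) * indicator S x + (\<Sum>j. ennreal (y (Suc j)) * indicator {x. ennreal (y j) < h x} x) \<partial>weight_space u)"
  proof (intro nn_integral_mono)
    fix x
    show "h x * indicator S x
       \<le> ennreal (y 0) * indicator S x + (\<Sum>j. ennreal (y (Suc j)) * indicator {x. ennreal (y j) < h x} x)"
      using le_step_function[of y "h x", OF y_pos y0]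
      by (auto split: split_indicator simp: indicator_def of_bool_def)
  qed
  also have "\<dots> = ennreal (y 0) * emeasure (weight_space u) S
      + (\<Sum>j. ennreal (y (Suc j)) * emeasure (weight_space u) {x. ennreal (y j) < h x})"
    using S(1) lev by (simp add: nn_integral_add nn_integral_suminf nn_integral_cmult_indicator)
  also have "\<dots> = ennreal (y 0) * weight_measure u S + (\<Sum>j. ennreal (y (Suc j)) * distr_fun u h (y j))"
    unfolding distr_fun_def using S(1) lev by (simp add: weight_measure_emeasure[OF u])
  also have "\<dots> \<le> ennreal (y 0) * ennreal t + (\<Sum>j. ennreal (y (Suc j)) * ennreal (t / 2 ^ j))"
    using S(2) level by (intro add_mono suminf_le mult_left_mono) auto
  also have "(\<Sum>j. ennreal (y (Suc j)) * ennreal (t / 2 ^ j)) = (\<Sum>j. ennreal (c * t * 2 * \<sigma> * \<sigma> ^ j))"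
    using c \<sigma> t by (intro suminf_cong) (simp add: y_eq power_mult_distrib flip: ennreal_mult)
  also have "\<dots> = ennreal (c * t * 2 * \<sigma> * (1 / (1 - \<sigma>)))"
    using c t \<sigma> by (intro suminf_ennreal_eq sums_mult geometric_sums) auto
  also have "ennreal (y 0) * ennreal t + ennreal (c * t * 2 * \<sigma> * (1 / (1 - \<sigma>)))
      = ennreal (y 0 * t + c * t * 2 * \<sigma> * (1 / (1 - \<sigma>)))"
    using c t \<sigma> y_pos[of 0] by (subst ennreal_plus) (auto simp: ennreal_mult)
  also have "y 0 * t + c * t * 2 * \<sigma> * (1 / (1 - \<sigma>)) = D * t * v powr (- (1 / q)) * b"
    by (simp add: y_eq c_def D_def algebra_simps)
  finally show ?thesis .
qed

text \<open>Extends the bound to \<open>b = 0\<close> and \<open>b = \<infinity>\<close>: a finite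
  \<open>b\<close> is replaced by \<open>r + e / c\<close>, which is positive and costs only
  \<open>e\<close> after multiplication by \<open>c\<close>.\<close>

lemma weak_integral_bound:
  assumes t: "0 < t" and v: "primitive w (ennreal t) = ennreal v" "0 < v"
    and S: "S \<in> sets lebesgue" "weight_measure u S \<le> ennreal t"
    and h: "h \<in> borel_measurable lebesgue"
    and weak: "\<And>z. 0 < z \<Longrightarrow> ennreal z * epow (primitive w (distr_fun u h z)) (1 / q) \<le> b"
  shows "(\<integral>\<^sup>+x\<in>S. h x \<partial>weight_space u) \<le> ennreal (D * t * v powr (- (1 / q))) * b"
proof -
  define c where "c = D * t * v powr (- (1 / q))"
  have c: "0 < c" using D_pos t v by (simp add: c_def)
  show ?thesis
    unfolding c_def[symmetric]
  proof (cases b)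
    case (real r)
    show "(\<integral>\<^sup>+x\<in>S. h x \<partial>weight_space u) \<le> ennreal c * b"
    proof (rule ennreal_le_epsilon)
      fix e :: real assume e: "0 < e"
      have "(\<integral>\<^sup>+x\<in>S. h x \<partial>weight_space u) \<le> ennreal (c * (r + e / c))"
      proof (rule weak_integral_bound_pos[OF t v S h, folded c_def])
        show "0 < r + e / c" using real c e by (simp add: add_nonneg_pos)
        have "b \<le> ennreal (r + e / c)"
          using real c e by (simp add: ennreal_leI)
        then show "ennreal z * epow (primitive w (distr_fun u h z)) (1 / q) \<le> ennreal (r + e / c)" if "0 < z" for z
          using weak[OF that] by (rule order_trans[rotated])
      qed
      also have "c * (r + e / c) = c * r + e"
        using c by (simp add: distrib_left)
      finally show "(\<integral>\<^sup>+x\<in>S. h x \<partial>weight_space u) \<le> ennreal c * b + ennreal e"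
        using real c e by (simp add: ennreal_mult)
    qed
  next
    case top
    then show "(\<integral>\<^sup>+x\<in>S. h x \<partial>weight_space u) \<le> ennreal c * b"
      using c by (simp add: ennreal_mult_top)
  qed
qed

text \<open>On a set \<open>S\<close> of measure \<open>t\<close> where the sum exceeds
  \<open>z\<close>, its integral is at least \<open>z * t\<close>. Integrals add, and each is
  bounded by \<open>weak_integral_bound\<close>; dividing by \<open>t * v powr (- (1 / q))\<close>
  gives the claim on \<open>S\<close>.\<close>

lemma weak_norm_suminf:
  assumes h: "\<And>k::nat. h k \<in> borel_measurable lebesgue"
    and weak: "\<And>k z. 0 < z \<Longrightarrow> ennreal z * epow (primitive w (distr_fun u (h k) z)) (1 / q) \<le> b k"
    and z: "0 < z"
  shows "ennreal z * epow (primitive w (distr_fun u (\<lambda>x. \<Sum>k. h k x) z)) (1 / q) \<le> ennreal D * (\<Sum>k. b k)"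
proof -
  note [measurable] = h weight_measurable[OF u]
  define R where "R = ennreal D * (\<Sum>k. b k)"
  \<comment> \<open>Cutting the superlevel set with balls makes its measure finite;
    \<open>primitive_SUP\<close> removes the cut at the end.\<close>
  define S where "S n = {x. ennreal z < (\<Sum>k. h k x)} \<inter> cball 0 (real n)" for n
  have S [measurable]: "S n \<in> sets lebesgue" for n
  proof -
    have "{x \<in> space lebesgue. ennreal z < (\<Sum>k. h k x)} \<in> sets lebesgue" by measurable
    then show ?thesis unfolding S_def by (intro sets.Int) auto
  qed
  have inc: "incseq S" by (auto simp: S_def incseq_def)
  have "\<exists>n. norm x \<le> real n" for x :: "real ^ 'n" by (rule real_arch_simple)
  then have "{x. ennreal z < (\<Sum>k. h k x)} = (\<Union>n. S n)"
    by (auto simp: S_def)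
  then have "distr_fun u (\<lambda>x. \<Sum>k. h k x) z = (SUP n. weight_measure u (S n))"
    unfolding distr_fun_def using weight_measure_SUP[OF u inc S] by simp
  moreover have "incseq (\<lambda>n. weight_measure u (S n))"
    using inc by (auto simp: incseq_def intro: weight_measure_mono)
  moreover have "set_borel_measurable lebesgue {0<..} w"
    using w by (simp add: weight_pos_def)
  ultimately have eq: "primitive w (distr_fun u (\<lambda>x. \<Sum>k. h k x) z) = (SUP n. primitive w (weight_measure u (S n)))"
    by (simp add: primitive_SUP)
  have bound: "ennreal z * epow (primitive w (weight_measure u (S n))) (1 / q) \<le> R" for n
  proof (cases "primitive w (weight_measure u (S n)) = 0")
    case False
    have fin: "weight_measure u (S n) < \<infinity>"
      by (rule weight_measure_finite[OF u, of _ "cball 0 (real n)"]) (auto simp: S_def)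
    then obtain t where t: "weight_measure u (S n) = ennreal t" "0 \<le> t"
      by (cases "weight_measure u (S n)") auto
    with False have "0 < t" by (cases "t = 0") auto
    obtain v where v: "primitive w (ennreal t) = ennreal v" "0 < v"
      using weight_pos_primitive_finite[OF w fin] False unfolding t(1)
      by (cases "primitive w (ennreal t)") (auto simp: order_less_le)
    have "ennreal z * ennreal t = (\<integral>\<^sup>+x. ennreal z * indicator (S n) x \<partial>weight_space u)"
      using t(1) by (simp add: nn_integral_cmult_indicator weight_measure_emeasure[OF u])
    also have "\<dots> \<le> (\<integral>\<^sup>+x. (\<Sum>k. h k x * indicator (S n) x) \<partial>weight_space u)"
      by (intro nn_integral_mono) (auto simp: S_def split: split_indicator)
    also have "\<dots> = (\<Sum>k. \<integral>\<^sup>+x\<in>S n. h k x \<partial>weight_space u)"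
      by (intro nn_integral_suminf) measurable
    also have "\<dots> \<le> (\<Sum>k. ennreal (D * t * v powr (- (1 / q))) * b k)"
      using t(1) weak by (intro suminf_le weak_integral_bound[OF \<open>0 < t\<close> v S _ h]) auto
    also have "\<dots> = ennreal (t * v powr (- (1 / q))) * R"
      unfolding R_def using D_pos \<open>0 < t\<close> by (simp add: ennreal_mult mult_ac)
    finally have "ennreal (v powr (1 / q) / t) * (ennreal z * ennreal t)
        \<le> ennreal (v powr (1 / q) / t) * (ennreal (t * v powr (- (1 / q))) * R)"
      by (rule mult_left_mono) simp
    moreover have "ennreal (v powr (1 / q) / t) * (ennreal z * ennreal t) = ennreal z * epow (ennreal v) (1 / q)"
      using \<open>0 < t\<close> z v by (simp add: epow_ennreal flip: ennreal_mult)
    moreover have "ennreal (v powr (1 / q) / t) * (ennreal (t * v powr (- (1 / q))) * R) = R"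
      using \<open>0 < t\<close> v by (simp add: mult.assoc[symmetric] powr_minus flip: ennreal_mult)
    ultimately show ?thesis by (simp add: t(1) v(1))
  qed simp
  have "(SUP n. primitive w (weight_measure u (S n))) \<le> epow (R / ennreal z) q"
  proof (rule SUP_least)
    fix n
    show "primitive w (weight_measure u (S n)) \<le> epow (R / ennreal z) q"
      using bound[of n] q unfolding le_divide_ennreal_iff[OF z, symmetric]
      by (simp add: epow_le_iff[of "1 / q"])
  qed
  then show ?thesis
    unfolding eq R_def[symmetric] le_divide_ennreal_iff[OF z, symmetric]
    using q by (simp add: epow_le_iff)
qed

end

section \<open>Weak type and the cube condition\<close>

text \<open>A finite geometric sum is dominated by its last term. If the term of index
  \<open>n\<close> is present then so are all earlier ones; if it is absent the sum does not
  change.\<close>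

lemma sum_powers_le:
  assumes p: "0 < (p :: real)" and a: "0 < a" and r: "0 \<le> r"
  shows "(1 - 2 powr - p) * (\<Sum>k<n. (2 ^ k * a) powr p * of_bool (2 ^ k * a \<le> r)) \<le> r powr p"
proof -
  define b where "b = (2 :: real) powr p"
  have b: "1 < b" using p by (simp add: b_def)
  have pow: "(2 ^ k * a) powr p = b ^ k * a powr p" for k
    using a by (simp add: b_def powr_mult powr_realpow[symmetric] powr_powr mult.commute)
  have geo: "(1 - 1 / b) * (\<Sum>k<Suc n. b ^ k) \<le> b ^ n" for n
  proof (induction n)
    case (Suc n)
    have "(1 - 1 / b) * (\<Sum>k<Suc (Suc n). b ^ k) = (1 - 1 / b) * (\<Sum>k<Suc n. b ^ k) + (1 - 1 / b) * b ^ Suc n"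
      by (simp add: distrib_left)
    also have "\<dots> \<le> b ^ n + (1 - 1 / b) * b ^ Suc n"
      using Suc by simp
    also have "\<dots> = b ^ Suc n"
      using b by (simp add: field_simps)
    finally show ?case .
  qed (use b in simp)
  have d: "2 powr - p = 1 / b" "0 \<le> 1 - 1 / b"
    using b by (simp_all add: powr_minus inverse_eq_divide flip: b_def)
  show ?thesis
  proof (induction n)
    case (Suc n)
    show ?case
    proof (cases "2 ^ n * a \<le> r")
      case True
      have "2 ^ k * a \<le> r" if "k \<le> n" for k
        using that a by (intro order_trans[OF _ True]) simp
      then have "(\<Sum>k<Suc n. (2 ^ k * a) powr p * of_bool (2 ^ k * a \<le> r)) = (\<Sum>k<Suc n. b ^ k * a powr p)"
        by (intro sum.cong) (auto simp: pow)
      then have "(1 - 2 powr - p) * (\<Sum>k<Suc n. (2 ^ k * a) powr p * of_bool (2 ^ k * a \<le> r))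
          = ((1 - 1 / b) * (\<Sum>k<Suc n. b ^ k)) * a powr p"
        by (simp only: d sum_distrib_right mult.assoc)
      also have "\<dots> \<le> b ^ n * a powr p"
        by (intro mult_right_mono geo) simp
      also have "\<dots> = (2 ^ n * a) powr p" by (simp add: pow)
      also have "\<dots> \<le> r powr p"
        using True a p by (intro powr_mono2) auto
      finally show ?thesis .
    qed (use Suc in simp)
  qed simp
qed

text \<open>Time \<open>s\<close> counts in the term of index \<open>k\<close> only if
  \<open>2 ^ k * a\<close> is at most the rearrangement at \<open>s\<close>. So at fixed
  \<open>s\<close> the sum is geometric and \<open>sum_powers_le\<close> bounds it; then integrate
  against \<open>w\<close>.\<close>

lemma dyadic_sum_le_norm:
  fixes u :: "real ^ 'n \<Rightarrow> real"
  assumes w: "weight_pos u w" and p: "0 < p" and a: "0 < a"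
  shows "ennreal (1 - 2 powr - p) *
      (\<Sum>k. ennreal ((2 ^ k * a) powr p) * primitive w (distr_fun u F (2 ^ k * a)))
    \<le> (\<integral>\<^sup>+t\<in>{0<..}. epow (rearr u F t) p * ennreal (w t) \<partial>lebesgue)"
proof -
  let ?L = "\<lambda>k. distr_fun u F (2 ^ k * a)"
  let ?w = "\<lambda>s. ennreal (w s) * indicator {0<..} s"
  let ?i = "\<lambda>k. indicator {s. ennreal s < ?L k} :: real \<Rightarrow> ennreal"
  define d where "d = 1 - 2 powr - p"
  have d: "0 < d" using p by (simp add: d_def powr_minus field_simps)
  have [measurable]: "?w \<in> borel_measurable lebesgue"
    using w by (intro measurable_pos_part) (simp add: weight_pos_def)
  have pt: "ennreal d * (\<Sum>k. ennreal ((2 ^ k * a) powr p) * ?i k s) \<le> epow (rearr u F s) p" for s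
  proof (cases "rearr u F s")
    case (real r)
    have le: "ennreal ((2 ^ k * a) powr p) * ?i k s \<le> ennreal ((2 ^ k * a) powr p * of_bool (2 ^ k * a \<le> r))" for k
      using le_rearr[of s u F "2 ^ k * a"] real by (auto split: split_indicator)
    have "(\<Sum>k. ennreal d * (ennreal ((2 ^ k * a) powr p) * ?i k s)) \<le> ennreal (r powr p)"
    proof (rule suminf_le_const)
      fix n
      have "(\<Sum>k<n. ennreal d * (ennreal ((2 ^ k * a) powr p) * ?i k s))
          \<le> (\<Sum>k<n. ennreal d * ennreal ((2 ^ k * a) powr p * of_bool (2 ^ k * a \<le> r)))"
        by (intro sum_mono mult_left_mono le) simp
      also have "\<dots> = ennreal (d * (\<Sum>k<n. (2 ^ k * a) powr p * of_bool (2 ^ k * a \<le> r)))"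
        using d by (simp add: sum_distrib_left sum_ennreal flip: ennreal_mult del: sum_mult_of_bool_eq)
      also have "\<dots> \<le> ennreal (r powr p)"
        unfolding d_def using sum_powers_le[OF p a] real by (intro ennreal_leI) auto
      finally show "(\<Sum>k<n. ennreal d * (ennreal ((2 ^ k * a) powr p) * ?i k s)) \<le> ennreal (r powr p)" .
    qed simp
    then show ?thesis using real by (simp add: epow_ennreal)
  qed simp
  have "ennreal d * (\<Sum>k. ennreal ((2 ^ k * a) powr p) * primitive w (?L k))
      = (\<integral>\<^sup>+s. ennreal d * (\<Sum>k. ennreal ((2 ^ k * a) powr p) * (?w s * ?i k s)) \<partial>lebesgue)"
    unfolding primitive_eq by (simp add: nn_integral_cmult nn_integral_suminf)
  also have "\<dots> \<le> (\<integral>\<^sup>+t\<in>{0<..}. epow (rearr u F t) p * ennreal (w t) \<partial>lebesgue)"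
  proof (rule nn_integral_mono)
    fix s
    have "ennreal d * (\<Sum>k. ennreal ((2 ^ k * a) powr p) * (?w s * ?i k s))
        = ?w s * (ennreal d * (\<Sum>k. ennreal ((2 ^ k * a) powr p) * ?i k s))"
      by (simp add: mult_ac flip: ennreal_suminf_cmult)
    also have "\<dots> \<le> ?w s * epow (rearr u F s) p"
      by (intro mult_left_mono pt) simp
    finally show "ennreal d * (\<Sum>k. ennreal ((2 ^ k * a) powr p) * (?w s * ?i k s))
        \<le> epow (rearr u F s) p * ennreal (w s) * indicator {0<..} s"
      by (simp add: mult_ac)
  qed
  finally show ?thesis by (simp add: d_def)
qed

lemma weak_type_of_cube_condition:
  fixes u0 u1 :: "real ^ 'n \<Rightarrow> real"
  assumes u: "weight u0" "weight u1" and w: "weight_pos u0 w0" "weight_pos u1 w1"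
    and p: "0 < p0" "p0 \<le> 1" "0 < p1" and B: "w1 \<in> B_class (p1 / p0)"
    and C: "C < \<infinity>" "cube_condition u0 w0 p0 u1 w1 p1 C"
  shows "maximal_bounded_weak u0 w0 p0 u1 w1 p1"
proof -
  define q where "q = p1 / p0"
  have q: "0 < q" using p by (simp add: q_def)
  obtain K \<sigma> where K: "1 \<le> K" "1 / 2 \<le> \<sigma>" "\<sigma> < 1"
      "\<And>t k. 0 < t \<Longrightarrow> primitive w1 (ennreal t)
       \<le> ennreal ((K * (2 * \<sigma>) ^ k) powr q) * primitive w1 (ennreal (t / 2 ^ k))"
    using B_class_growth[OF B w(2)] q unfolding q_def by blast
  interpret G: weight_growth u1 w1 q K \<sigma>
    using u w q K by unfold_locales auto
  have w1: "set_borel_measurable lebesgue {0<..} w1"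
    using w by (simp add: weight_pos_def)
  define d where "d = 1 - 2 powr - p0"
  have d: "0 < d" using p by (simp add: d_def powr_minus field_simps)
  \<comment> \<open>Obtained by solving the last estimate for \<open>y * X\<close>. The 4 is the
    product of the 2 in \<open>a = y / 2\<close> and the 2 in the level
    \<open>(1 / 2) powr p0\<close>.\<close>
  define A where "A = ennreal (4 / d powr (1 / p0)) * epow (ennreal G.D * epow C p0) (1 / p0)"
  have A: "A < \<infinity>"
    using C(1) by (auto simp: A_def ennreal_mult_less_top intro!: epow_less_top)
  have "weak_lorentz_norm u1 w1 p1 (maximal f) \<le> A * lorentz_norm u0 w0 p0 (\<lambda>x. ennreal (cmod (f x)))"
    if f [measurable]: "f \<in> borel_measurable lebesgue" for f :: "real ^ 'n \<Rightarrow> complex"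
    unfolding weak_norm_bound_iff[OF w1 p(3)]
  proof (intro allI impI)
    fix y :: real assume y: "0 < y"
    define F where "F x = ennreal (cmod (f x))" for x
    define a where "a = y / 2"
    have a: "0 < a" using y by (simp add: a_def)
    define E where "E k = {x. ennreal (2 ^ k * a) < F x}" for k :: nat
    have E: "E k \<in> sets lebesgue" for k
    proof -
      have "{x \<in> space lebesgue. ennreal (2 ^ k * a) < F x} \<in> sets lebesgue"
        unfolding F_def by measurable
      then show ?thesis by (simp add: E_def)
    qed
    have uE: "weight_measure u0 (E k) = distr_fun u0 F (2 ^ k * a)" for k
      by (simp add: distr_fun_def E_def)
    define M where "M k = maximal (indicator (E k))" for k
    \<comment> \<open>Taking the power \<open>p0\<close> turns the weak exponent \<open>p1\<close>
      into \<open>q = p1 / p0\<close>, for which the functional is countably subadditive.\<close>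
    define h where "h k x = epow (ennreal (2 ^ k) * M k x) p0" for k x
    define b where "b k = ennreal ((2 ^ k) powr p0) * epow C p0 * primitive w0 (weight_measure u0 (E k))" for k :: nat
    have h_meas: "h k \<in> borel_measurable lebesgue" for k
      using maximal_measurable unfolding h_def M_def by measurable
    have h_weak: "ennreal z * epow (primitive w1 (distr_fun u1 (h k) z)) (1 / q) \<le> b k" if z: "0 < z" for k z
    proof -
      \<comment> \<open>The level at which \<open>(2 ^ k * s) powr p0 = z\<close>.\<close>
      define s where "s = z powr (1 / p0) / 2 ^ k"
      have s: "0 < s" using z by (simp add: s_def)
      have "ennreal s < M k x" if "ennreal z < h k x" for x
      proof (rule ccontr)
        assume "\<not> ?thesis"
        then have "h k x \<le> epow (ennreal (2 ^ k) * ennreal s) p0"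
          unfolding h_def using p by (intro epow_mono mult_left_mono) auto
        also have "\<dots> = ennreal z"
          using z p by (simp add: s_def epow_ennreal powr_powr flip: ennreal_mult)
        finally show False using that by simp
      qed
      then have "distr_fun u1 (h k) z \<le> distr_fun u1 (M k) s"
        unfolding distr_fun_def by (intro weight_measure_mono) auto
      then have "ennreal s * epow (primitive w1 (distr_fun u1 (h k) z)) (1 / p1)
          \<le> ennreal s * epow (primitive w1 (distr_fun u1 (M k) s)) (1 / p1)"
        using p by (intro mult_left_mono epow_mono primitive_mono) auto
      also have "\<dots> \<le> C * epow (primitive w0 (weight_measure u0 (E k))) (1 / p0)"
        unfolding M_def by (rule restricted_weak_type[OF u w p(1,3) C E s])
      finally have "epow (ennreal s * epow (primitive w1 (distr_fun u1 (h k) z)) (1 / p1)) p0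
          \<le> epow (C * epow (primitive w0 (weight_measure u0 (E k))) (1 / p0)) p0"
        using p by (intro epow_mono) auto
      then have "ennreal ((2 ^ k) powr p0) * (epow (ennreal s) p0 * epow (primitive w1 (distr_fun u1 (h k) z)) (1 / q))
          \<le> ennreal ((2 ^ k) powr p0) * (epow C p0 * primitive w0 (weight_measure u0 (E k)))"
        using p by (intro mult_left_mono) (auto simp: epow_mult epow_epow q_def)
      moreover have "ennreal ((2 ^ k) powr p0) * epow (ennreal s) p0 = ennreal z"
        using z p by (simp add: s_def epow_ennreal powr_powr powr_divide flip: ennreal_mult)
      ultimately show ?thesis
        by (simp add: b_def mult.assoc[symmetric])
    qed
    have "ennreal ((1 / 2) powr p0) < (\<Sum>k. h k x)" if x: "ennreal y < maximal f x" for x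
    proof -
      define G where "G = (\<Sum>k. ennreal (2 ^ k) * M k x)"
      \<comment> \<open>The coefficient \<open>2 ^ k * y\<close> is the next level
        \<open>2 ^ Suc k * a\<close>, as in \<open>le_step_function\<close>. The part of
        \<open>f\<close> below \<open>a\<close> contributes at most \<open>y / 2\<close>, so the sum
        must account for the other half.\<close>
      have "maximal f x \<le> ennreal a + (\<Sum>k. ennreal (2 ^ k * y) * M k x)"
        unfolding M_def
      proof (rule maximal_le_suminf)
        show "indicator (E k) \<in> borel_measurable lebesgue" for k
          using E by measurable
        fix z
        have "F z \<le> ennreal a + (\<Sum>k. ennreal (2 ^ k * y) * of_bool (ennreal (2 ^ k * a) < F z))"
          using le_step_function[of "\<lambda>k. 2 ^ k * a" "F z"] a by (simp add: a_def)
        moreover have "ennreal (cmod (indicator (E k) z)) = of_bool (ennreal (2 ^ k * a) < F z)" for k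
          by (simp add: E_def indicator_def)
        ultimately show "ennreal (cmod (f z)) \<le> ennreal a + (\<Sum>k. ennreal (2 ^ k * y) * ennreal (cmod (indicator (E k) z)))"
          by (simp only: F_def[symmetric])
      qed
      also have "(\<Sum>k. ennreal (2 ^ k * y) * M k x) = ennreal y * G"
        using y by (simp add: G_def ennreal_mult mult_ac flip: ennreal_suminf_cmult)
      finally have "ennreal y < ennreal a + ennreal y * G"
        using x by simp
      moreover have "ennreal a + ennreal y * G \<le> ennreal y" if "G \<le> ennreal (1 / 2)"
      proof -
        have "ennreal a + ennreal y * G \<le> ennreal a + ennreal y * ennreal (1 / 2)"
          using that by (intro add_mono mult_left_mono) auto
        also have "\<dots> = ennreal y"
          unfolding a_def using y
          by (subst ennreal_mult[symmetric], simp, simp, subst ennreal_plus[symmetric]) auto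
        finally show ?thesis .
      qed
      ultimately have "ennreal (1 / 2) < G" by (meson leD leI)
      then have "epow (ennreal (1 / 2)) p0 < epow G p0"
        using p by (intro epow_strict_mono)
      also have "\<dots> \<le> (\<Sum>k. h k x)"
        unfolding G_def h_def using p by (intro epow_suminf_le)
      also have "epow (ennreal (1 / 2)) p0 = ennreal ((1 / 2) powr p0)"
        by (rule epow_ennreal) simp
      finally show ?thesis .
    qed
    then have "distr_fun u1 (maximal f) y \<le> distr_fun u1 (\<lambda>x. \<Sum>k. h k x) ((1 / 2) powr p0)"
      unfolding distr_fun_def by (intro weight_measure_mono) auto
    then have "ennreal ((1 / 2) powr p0) * epow (primitive w1 (distr_fun u1 (maximal f) y)) (1 / q)
        \<le> ennreal ((1 / 2) powr p0) * epow (primitive w1 (distr_fun u1 (\<lambda>x. \<Sum>k. h k x) ((1 / 2) powr p0))) (1 / q)"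
      using q by (intro mult_left_mono epow_mono primitive_mono) auto
    also have "\<dots> \<le> ennreal G.D * (\<Sum>k. b k)"
      using h_meas h_weak by (intro G.weak_norm_suminf) auto
    finally have 1: "ennreal ((1 / 2) powr p0) * epow (primitive w1 (distr_fun u1 (maximal f) y)) (1 / q)
        \<le> ennreal G.D * (\<Sum>k. b k)" .
    define X where "X = epow (primitive w1 (distr_fun u1 (maximal f) y)) (1 / p1)"
    define R where "R = lorentz_norm u0 w0 p0 F"
    have X: "epow (primitive w1 (distr_fun u1 (maximal f) y)) (1 / q) = epow X p0"
      using p by (simp add: X_def q_def epow_epow)
    have R: "epow R p0 = (\<integral>\<^sup>+t\<in>{0<..}. epow (rearr u0 F t) p0 * ennreal (w0 t) \<partial>lebesgue)"
      using p by (simp add: R_def lorentz_norm_def epow_inverse)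
    \<comment> \<open>The factor \<open>a powr p0\<close> turns the coefficients in
      \<open>b k\<close> into \<open>(2 ^ k * a) powr p0\<close>, as
      \<open>dyadic_sum_le_norm\<close> requires.\<close>
    have "ennreal d * (ennreal (a powr p0) * (\<Sum>k. b k))
        = epow C p0 * (ennreal d * (\<Sum>k. ennreal ((2 ^ k * a) powr p0) * primitive w0 (distr_fun u0 F (2 ^ k * a))))"
      using a by (simp add: b_def uE powr_mult ennreal_mult mult_ac flip: ennreal_suminf_cmult)
    also have "\<dots> \<le> epow C p0 * epow R p0"
      unfolding d_def R by (intro mult_left_mono dyadic_sum_le_norm w p a) simp
    finally have 2: "ennreal d * (ennreal (a powr p0) * (\<Sum>k. b k)) \<le> epow C p0 * epow R p0" .
    have "ennreal (d * (y / 4) powr p0) * epow X p0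
        = ennreal d * ennreal (a powr p0) * (ennreal ((1 / 2) powr p0) * epow X p0)"
    proof -
      have "(y / 4) powr p0 = a powr p0 * (1 / 2) powr p0"
        using powr_mult[of a "1 / 2" p0] a by (simp add: a_def)
      then have "ennreal (d * (y / 4) powr p0) = ennreal d * ennreal (a powr p0) * ennreal ((1 / 2) powr p0)"
        using d by (simp add: mult.assoc flip: ennreal_mult)
      then show ?thesis by (simp only: mult.assoc)
    qed
    also have "\<dots> \<le> ennreal d * ennreal (a powr p0) * (ennreal G.D * (\<Sum>k. b k))"
      using 1 unfolding X by (rule mult_left_mono) simp
    also have "\<dots> = ennreal G.D * (ennreal d * (ennreal (a powr p0) * (\<Sum>k. b k)))"
      by (simp add: mult_ac)
    also have "\<dots> \<le> ennreal G.D * (epow C p0 * epow R p0)"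
      using 2 by (rule mult_left_mono) simp
    finally have "epow (ennreal (d * (y / 4) powr p0) * epow X p0) (1 / p0)
        \<le> epow (ennreal G.D * epow C p0 * epow R p0) (1 / p0)"
      using p by (intro epow_mono) (auto simp: mult.assoc)
    then have "ennreal (d powr (1 / p0) * (y / 4)) * X \<le> epow (ennreal G.D * epow C p0) (1 / p0) * R"
      using p y d by (simp add: epow_mult epow_inverse epow_ennreal powr_mult powr_powr)
    then have "ennreal (4 / d powr (1 / p0)) * (ennreal (d powr (1 / p0) * (y / 4)) * X) \<le> A * R"
      unfolding A_def mult.assoc by (rule mult_left_mono) simp
    moreover have "ennreal (4 / d powr (1 / p0)) * (ennreal (d powr (1 / p0) * (y / 4)) * X) = ennreal y * X"
      using d y by (simp add: mult.assoc[symmetric] flip: ennreal_mult)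
    ultimately show "ennreal y * epow (primitive w1 (distr_fun u1 (maximal f) y)) (1 / p1)
        \<le> A * lorentz_norm u0 w0 p0 (\<lambda>x. ennreal (cmod (f x)))"
      by (simp add: X_def R_def F_def[abs_def])
  qed
  then show ?thesis
    unfolding maximal_bounded_weak_def using A by blast
qed

section \<open>Necessity: testing on indicator functions\<close>

lemma lorentz_norm_indicator_le:
  fixes u :: "real ^ 'n \<Rightarrow> real"
  assumes p: "0 < p"
  shows "lorentz_norm u w p (\<lambda>x. ennreal (cmod (indicator E x))) \<le> epow (primitive w (weight_measure u E)) (1 / p)"
proof -
  let ?F = "\<lambda>x. ennreal (cmod (indicator E x))"
  have distr: "distr_fun u ?F s \<le> (if s < 1 then weight_measure u E else 0)" if "0 < s" for s
  proof (cases "s < 1")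
    case True
    then show ?thesis
      unfolding distr_fun_def by (auto intro!: weight_measure_mono split: split_indicator_asm)
  next
    case False
    then have "{x. ennreal s < ?F x} = {}"
      by (auto simp: not_less ennreal_leI simp flip: ennreal_1 split: split_indicator)
    then show ?thesis
      unfolding distr_fun_def by (simp add: weight_measure_def)
  qed
  have le: "epow (rearr u ?F t) p \<le> indicator {t. ennreal t < weight_measure u E} t" if "0 < t" for t
  proof (cases "ennreal t < weight_measure u E")
    case True
    have "rearr u ?F t \<le> ennreal 1"
      unfolding rearr_def using distr[of 1] by (intro INF_lower) auto
    then have "epow (rearr u ?F t) p \<le> epow 1 p"
      using p by (intro epow_mono) auto
    then show ?thesis using True by simp
  next
    case False
    \<comment> \<open>The infimum runs over positive levels only, so 0 is reached as a limit;
      \<open>0 + ennreal e\<close> is the form expected by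
      \<open>ennreal_le_epsilon\<close>.\<close>
    have eps: "rearr u ?F t \<le> 0 + ennreal e" if "0 < e" for e
      unfolding rearr_def using distr[OF that] False that
      by (auto intro!: INF_lower simp: not_less split: if_splits intro: order_trans)
    have "rearr u ?F t \<le> 0"
      by (rule ennreal_le_epsilon) (rule eps)
    then show ?thesis by simp
  qed
  show ?thesis
    unfolding lorentz_norm_def primitive_eq
  proof (intro epow_mono nn_integral_mono)
    fix t
    show "epow (rearr u ?F t) p * ennreal (w t) * indicator {0<..} t
        \<le> ennreal (w t) * indicator {0<..} t * indicator {s. ennreal s < weight_measure u E} t"
      using mult_right_mono[OF le[of t], of "ennreal (w t)"] by (cases "0 < t") (auto simp: mult.commute)
  qed (use p in simp)
qed

text \<open>Let \<open>V\<close> be the union of the sets \<open>E j\<close> and \<open>m\<close>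
  the largest ratio. Each \<open>Q j\<close> has density of \<open>V\<close> at least
  \<open>1 / m\<close>, so it lies in every superlevel set of the maximal function of
  \<open>indicator V\<close> of level below \<open>1 / m\<close>.\<close>

lemma cube_condition_of_weak_type:
  fixes u0 u1 :: "real ^ 'n \<Rightarrow> real"
  assumes u: "weight u0" "weight u1" and w: "weight_pos u0 w0" "weight_pos u1 w1"
    and p: "0 < p0" "0 < p1" and M: "maximal_bounded_weak u0 w0 p0 u1 w1 p1"
  obtains C where "C < \<infinity>" "cube_condition u0 w0 p0 u1 w1 p1 C"
proof -
  have w1: "set_borel_measurable lebesgue {0<..} w1"
    using w by (simp add: weight_pos_def)
  obtain C where C: "C < \<infinity>" "\<And>f. f \<in> borel_measurable lebesgue \<Longrightarrow>
     lorentz_norm u0 w0 p0 (\<lambda>x. ennreal (cmod (f x))) < \<infinity> \<Longrightarrow>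
     weak_lorentz_norm u1 w1 p1 (maximal f) \<le> C * lorentz_norm u0 w0 p0 (\<lambda>x. ennreal (cmod (f x)))"
    using M by (auto simp: maximal_bounded_weak_def)
  \<comment> \<open>With \<open>C + 1\<close> the right-hand side is infinite when \<open>m\<close>
    is; for \<open>C = 0\<close> the convention \<open>0 * \<infinity> = 0\<close> would spoil this
    case.\<close>
  have "cube_condition u0 w0 p0 u1 w1 p1 (C + 1)"
    unfolding cube_condition_def
  proof (intro allI impI)
    fix J :: nat and Q E :: "nat \<Rightarrow> (real ^ 'n) set"
    assume J: "1 \<le> J" and Q: "\<forall>j\<in>{1..J}. cube (Q j)"
      and E: "\<forall>j\<in>{1..J}. E j \<in> sets lebesgue \<and> E j \<subseteq> Q j"
    define m where "m = (MAX j\<in>{1..J}. emeasure lebesgue (Q j) / emeasure lebesgue (E j))"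
    define V where "V = (\<Union>j\<in>{1..J}. E j)"
    define a where "a = epow (primitive w1 (weight_measure u1 (\<Union>j\<in>{1..J}. Q j))) (1 / p1)"
    define b where "b = epow (primitive w0 (weight_measure u0 V)) (1 / p0)"
    have le_m: "emeasure lebesgue (Q j) / emeasure lebesgue (E j) \<le> m" if "j \<in> {1..J}" for j
      unfolding m_def using that by (intro Max_ge) auto
    have "a / b \<le> (C + 1) * m"
    proof (cases "m = top")
      case True
      then show ?thesis by (simp add: ennreal_mult_top)
    next
      case False
      have V: "V \<in> sets lebesgue"
        unfolding V_def using E by (intro sets.finite_UN) auto
      have "weight_measure u0 V < \<infinity>"
        using E Q by (intro weight_measure_finite[OF u(1), of _ "\<Union>j\<in>{1..J}. Q j"] compact_UN)
          (auto simp: V_def cube_compact)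
      then have b: "b < \<infinity>"
        unfolding b_def using weight_pos_primitive_finite[OF w(1)] by (auto intro: epow_less_top)
      have avg: "1 / m \<le> average (indicator V) (Q j)" if j: "j \<in> {1..J}" for j
      proof -
        obtain r where r: "0 < r" "emeasure lebesgue (Q j) = ennreal r"
          using Q j by (meson cube_emeasure_pos)
        have Qj: "Q j \<in> sets lebesgue" using Q j by auto
        have "emeasure lebesgue (E j) \<le> ennreal r"
          unfolding r(2)[symmetric] using E j Qj by (intro emeasure_mono) auto
        then obtain e where e: "emeasure lebesgue (E j) = ennreal e" "0 \<le> e"
          by (cases "emeasure lebesgue (E j)") (auto simp: top_unique)
        obtain n where n: "m = ennreal n" "0 \<le> n"
          using False by (cases m) auto
        have "ennreal r / ennreal e \<le> ennreal n"
          using le_m[OF j] by (simp add: r e n)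
        \<comment> \<open>A null \<open>E j\<close> would make its ratio, hence \<open>m\<close>,
          infinite.\<close>
        then have "0 < e"
          using e r by (cases "e = 0") (auto simp: top_unique)
        then have "r / e \<le> n"
          using \<open>ennreal r / ennreal e \<le> ennreal n\<close> r n by (simp add: divide_ennreal)
        moreover have "0 < r / e" using r \<open>0 < e\<close> by simp
        ultimately have "0 < n" by linarith
        have "1 / n \<le> e / r"
          using \<open>r / e \<le> n\<close> \<open>0 < e\<close> \<open>0 < n\<close> r by (simp add: field_simps)
        then have "1 / m \<le> ennreal e / ennreal r"
          using \<open>0 < n\<close> \<open>0 < e\<close> r n divide_ennreal[of 1 n] by (simp add: divide_ennreal ennreal_leI)
        also have "\<dots> \<le> emeasure lebesgue (V \<inter> Q j) / ennreal r"
          unfolding e(1)[symmetric] using E j V Qj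
          by (intro divide_right_mono_ennreal emeasure_mono) (auto simp: V_def)
        finally show ?thesis
          unfolding average_indicator[OF V Qj] unfolding r(2) .
      qed
      have norm: "lorentz_norm u0 w0 p0 (\<lambda>x. ennreal (cmod (indicator V x))) \<le> b"
        unfolding b_def by (rule lorentz_norm_indicator_le[OF p(1)])
      have "indicator V \<in> borel_measurable lebesgue" using V by measurable
      then have "weak_lorentz_norm u1 w1 p1 (maximal (indicator V))
          \<le> C * lorentz_norm u0 w0 p0 (\<lambda>x. ennreal (cmod (indicator V x)))"
        using norm b by (intro C(2)) auto
      also have "\<dots> \<le> C * b"
        using norm by (rule mult_left_mono) simp
      finally have weak: "ennreal z * epow (primitive w1 (distr_fun u1 (maximal (indicator V)) z)) (1 / p1) \<le> C * b"
        if "0 < z" for z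
        using that unfolding weak_norm_bound_iff[OF w1 p(2)] by blast
      \<comment> \<open>The superlevel sets are strict, so \<open>1 / m\<close> itself is not an
        admissible level; it is recovered as the supremum of the smaller ones.\<close>
      have lower: "z * a \<le> C * b" if z: "z < 1 / m" for z
      proof (cases z)
        case (real s)
        show ?thesis
        proof (cases "s = 0")
          case False
          have "(\<Union>j\<in>{1..J}. Q j) \<subseteq> {x. ennreal s < maximal (indicator V) x}"
          proof
            fix x assume "x \<in> (\<Union>j\<in>{1..J}. Q j)"
            then obtain j where j: "j \<in> {1..J}" "x \<in> Q j" by blast
            have "ennreal s < 1 / m" using z real by simp
            also have "\<dots> \<le> average (indicator V) (Q j)" by (rule avg[OF j(1)])
            also have "\<dots> \<le> maximal (indicator V) x"
              using Q j by (intro average_le_maximal) auto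
            finally show "x \<in> {x. ennreal s < maximal (indicator V) x}" by simp
          qed
          then have "a \<le> epow (primitive w1 (distr_fun u1 (maximal (indicator V)) s)) (1 / p1)"
            unfolding a_def distr_fun_def using p by (intro epow_mono primitive_mono weight_measure_mono) auto
          then have "z * a \<le> z * epow (primitive w1 (distr_fun u1 (maximal (indicator V)) s)) (1 / p1)"
            by (rule mult_left_mono) simp
          also have "\<dots> \<le> C * b"
            using weak[of s] False real by simp
          finally show ?thesis .
        qed (use real in simp)
      qed (use z in simp)
      have "1 / m * a = (SUP z\<in>{..<1 / m}. z * a)"
        using SUP_mult_right_ennreal[of "\<lambda>z. z" "{..<1 / m}" a] by simp
      also have "\<dots> \<le> C * b"
        using lower by (intro SUP_least) auto
      finally have le: "1 / m * a \<le> C * b" .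
      show ?thesis
      proof (cases "a = 0")
        case False
        have "1 / m * a < top"
          using b C(1) by (intro le_less_trans[OF le]) (simp add: ennreal_mult_less_top)
        then have "m \<noteq> 0"
          using False by (auto simp: ennreal_top_mult)
        have "b \<noteq> 0"
          using le False \<open>m \<noteq> top\<close> by auto
        define \<beta> where "\<beta> = enn2real b"
        have \<beta>: "b = ennreal \<beta>" "0 < \<beta>"
          using b \<open>b \<noteq> 0\<close> by (auto simp: \<beta>_def enn2real_positive_iff zero_less_iff_neq_zero)
        have "a = m * (1 / m) * a"
          using \<open>m \<noteq> 0\<close> \<open>m \<noteq> top\<close> by (simp add: ennreal_times_divide less_top)
        also have "\<dots> \<le> m * (C * b)"
          using mult_left_mono[OF le, of m] by (simp add: mult.assoc)
        also have "\<dots> \<le> m * ((C + 1) * b)"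
          by (intro mult_left_mono mult_right_mono) auto
        finally have "a \<le> b * ((C + 1) * m)"
          by (simp add: mult_ac)
        then show ?thesis
          unfolding \<beta>(1) divide_ennreal_le_iff[OF \<beta>(2)] .
      qed simp
    qed
    then show "epow (primitive w1 (weight_measure u1 (\<Union>j\<in>{1..J}. Q j))) (1 / p1)
         / epow (primitive w0 (weight_measure u0 (\<Union>j\<in>{1..J}. E j))) (1 / p0)
       \<le> (C + 1) * (MAX j\<in>{1..J}. emeasure lebesgue (Q j) / emeasure lebesgue (E j))"
      by (simp add: a_def b_def m_def V_def)
  qed
  then show ?thesis
    using C(1) by (intro that[of "C + 1"]) auto
qed

theorem theorem3p2p11:
  fixes u0 u1 :: "real ^ 'n \<Rightarrow> real" and w0 w1 :: "real \<Rightarrow> real" and p0 p1 :: real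
  assumes "weight u0" and "weight u1"
    and "weight_pos u0 w0" and "weight_pos u1 w1"
    and "0 < p0" and "p0 \<le> 1" and "0 < p1"
    and "w1 \<in> B_class (p1 / p0)"
  shows "maximal_bounded_weak u0 w0 p0 u1 w1 p1 \<longleftrightarrow>
    (\<exists>C<\<infinity>. \<forall>(J::nat) (Q :: nat \<Rightarrow> (real ^ 'n) set) (E :: nat \<Rightarrow> (real ^ 'n) set).
       1 \<le> J \<longrightarrow> (\<forall>j\<in>{1..J}. cube (Q j)) \<longrightarrow>
       (\<forall>j\<in>{1..J}. E j \<in> sets lebesgue \<and> E j \<subseteq> Q j) \<longrightarrow>
       epow (primitive w1 (weight_measure u1 (\<Union>j\<in>{1..J}. Q j))) (1 / p1)
         / epow (primitive w0 (weight_measure u0 (\<Union>j\<in>{1..J}. E j))) (1 / p0)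
       \<le> C * (MAX j\<in>{1..J}. emeasure lebesgue (Q j) / emeasure lebesgue (E j)))"
  unfolding cube_condition_def[symmetric]
  using cube_condition_of_weak_type[OF assms(1-5,7)]
    weak_type_of_cube_condition[OF assms(1-4,5-8)]
  by blast

end
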